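(* For each $n$ choose an element $g_n\in F$ of Thompson's group to have support in $[r_n,s_n]\subseteq[0,1]$, where $r_n<s_n<2r_n$ and $\lim_{n\to\infty}r_n=0$, and choose a word $w_n$ in $a^{\pm1},b^{\pm1}$ so that $w_n(x_0,x_1)=g_n$. Let $$G_n=\langle a,b,c\mid R_1=[ba^{-1},a^{-1}ba],\ R_2=[ba^{-1},a^{-2}ba^2],\ c^{-1}w_n(a,b)\rangle .$$ Then the sequence of marked groups $(G_n,\{a,b,c\})$ converges in $\mathcal G_3$ to $(G,\{a,b,c\})$, where $$G=\langle a,b,c\mid R_1,\ R_2,\ [a^ica^{-i},c],\ [a^iba^{-i},c]\ \text{ for every } i\in\mathbb Z\rangle .$$
   Context: Thompson's group $F$ is the group of orientation-preserving piecewise-linear homeomorphisms of $[0,1]$ whose breakpoints have dyadic rational coordinates and whose slopes are powers of $2$; the product is composition, $(fg)(t)=f(g(t))$. The support of $f\in F$ is the closure of $\{t: f(t)\neq t\}$. The element $x_0$ maps $[0,\frac12]$, $[\frac12,\frac34]$, $[\frac34,1]$ linearly and increasingly onto $[0,\frac14]$, $[\frac14,\frac12]$, $[\frac12,1]$ respectively. The element $x_1$ is the identity on $[0,\frac12]$ and $x_1(t)=\frac12+\frac12x_0(2t-1)$ on $[\frac12,1]$. $F$ has the presentation $\langle x_0,x_1\mid [x_1x_0^{-1},x_0^{-1}x_1x_0],[x_1x_0^{-1},x_0^{-2}x_1x_0^2]\rangle$, so each $G_n$ is a copy of $F$ with $a=x_0$, $b=x_1$, $c=g_n$. Here $[x,y]$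 denotes the commutator. A marked group $(G,S)$ is a group $G$ with a fixed ordered finite generating set $S$; $\mathcal G_3$ is the set of groups marked by $3$ elements, up to isomorphism of marked groups. Identifying generators of each marked group with a fixed basis of the free group $F_3$ of rank $3$, two marked groups are at distance at most $e^{-R}$ if they have the same relations (words representing the identity) of length at most $R$; convergence is with respect to this topology. Equivalently, $(\Gamma_n,S_n)\to(\Gamma,S)$ if and only if every word $w\in F_3$ trivial in $\Gamma$ is trivial in $\Gamma_n$ for all large $n$, and every $w\in F_3$ trivial in $\Gamma_n$ for infinitely many $n$ is trivial in $\Gamma$.
   Formalization: The elements g_n are additionally assumed to be nontrivial for all but finitely many n; if g_n is the identity infinitely often, c is trivial in infinitely many G_n but has infinite order in G, so convergence fails. *)

theory Defs
  imports "HOL-Analysis.Analysis" "HOL-Algebra.Coset" "HOL-Algebra.Generated_Groups"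
    "HOL-Real_Asymp.Real_Asymp"
begin

section \<open>Words, free groups and presentations\<close>

text \<open>The letter \<open>(x, True)\<close> stands for the generator \<open>x\<close> and \<open>(x, False)\<close> for its inverse.\<close>

type_synonym 'x gword = "('x \<times> bool) list"

definition words :: "'x set \<Rightarrow> 'x gword set" where
  "words X = lists (X \<times> UNIV)"

definition gen :: "'x \<Rightarrow> 'x gword" where
  "gen x = [(x, True)]"

definition winv :: "'x gword \<Rightarrow> 'x gword" where
  "winv w = rev (map (\<lambda>(x, e). (x, \<not> e)) w)"

definition wpow :: "'x gword \<Rightarrow> int \<Rightarrow> 'x gword" where
  "wpow w i = (if 0 \<le> i then concat (replicate (nat i) w)
               else concat (replicate (nat (- i)) (winv w)))"

definition wconj :: "'x gword \<Rightarrow> 'x gword \<Rightarrow> 'x gword" where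
  "wconj u v = u @ v @ winv u"

definition wcomm :: "'x gword \<Rightarrow> 'x gword \<Rightarrow> 'x gword" where
  "wcomm u v = u @ v @ winv u @ winv v"

inductive cancels :: "'x gword \<Rightarrow> 'x gword \<Rightarrow> bool" where
  "cancels (u @ [(x, e), (x, \<not> e)] @ v) (u @ v)"

definition free_rel :: "'x set \<Rightarrow> ('x gword \<times> 'x gword) set" where
  "free_rel X = {(u, v). u \<in> words X \<and> v \<in> words X \<and> equivclp cancels u v}"

definition free_class :: "'x set \<Rightarrow> 'x gword \<Rightarrow> 'x gword set" where
  "free_class X w = free_rel X `` {w}"

definition free_group :: "'x set \<Rightarrow> 'x gword set monoid" where
  "free_group X = \<lparr>carrier = words X // free_rel X,
     mult = (\<lambda>U V. \<Union>u\<in>U. \<Union>v\<in>V. free_class X (u @ v)),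
     one = free_class X []\<rparr>"

definition normal_closure :: "('g, 'm) monoid_scheme \<Rightarrow> 'g set \<Rightarrow> 'g set" where
  "normal_closure G A = \<Inter> {N. N \<lhd> G \<and> A \<subseteq> N}"

definition relator_closure :: "'x set \<Rightarrow> 'x gword set \<Rightarrow> 'x gword set set" where
  "relator_closure X R = normal_closure (free_group X) (free_class X ` R)"

definition presented_group :: "'x set \<Rightarrow> 'x gword set \<Rightarrow> 'x gword set set monoid" where
  "presented_group X R = free_group X Mod relator_closure X R"

definition presented_gen :: "'x set \<Rightarrow> 'x gword set \<Rightarrow> 'x \<Rightarrow> 'x gword set set" where
  "presented_gen X R x = relator_closure X R #>\<^bsub>free_group X\<^esub> free_class X (gen x)"


section \<open>The space of marked groups\<close>

text \<open>A marking is a list of group elements; a word over \<open>{..<k}\<close> is a word in the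
  \<open>k\<close> entries of the marking.\<close>

definition letter_value :: "('g, 'm) monoid_scheme \<Rightarrow> 'g list \<Rightarrow> nat \<times> bool \<Rightarrow> 'g" where
  "letter_value G S l = (if snd l then S ! fst l else inv\<^bsub>G\<^esub> (S ! fst l))"

definition word_value :: "('g, 'm) monoid_scheme \<Rightarrow> 'g list \<Rightarrow> nat gword \<Rightarrow> 'g" where
  "word_value G S w = foldr (\<lambda>l y. letter_value G S l \<otimes>\<^bsub>G\<^esub> y) w \<one>\<^bsub>G\<^esub>"

type_synonym 'g marked_group = "'g monoid \<times> 'g list"

definition marked_groups :: "nat \<Rightarrow> 'g marked_group set" where
  "marked_groups k = {(G, S). group G \<and> length S = k \<and> set S \<subseteq> carrier G \<and>
                              generate G (set S) = carrier G}"

definition marked_iso_rel :: "nat \<Rightarrow> ('g marked_group \<times> 'g marked_group) set" where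
  "marked_iso_rel k = {((G, S), (H, T)). (G, S) \<in> marked_groups k \<and> (H, T) \<in> marked_groups k \<and>
                                        (\<exists>h \<in> iso G H. map h S = T)}"

definition marked_class :: "nat \<Rightarrow> 'g marked_group \<Rightarrow> 'g marked_group set" where
  "marked_class k M = marked_iso_rel k `` {M}"

definition marked_space :: "nat \<Rightarrow> 'g marked_group set set" where
  "marked_space k = marked_groups k // marked_iso_rel k"

text \<open>Isomorphic marked groups have the same relations, so for a class in \<open>marked_space k\<close> the
  intersection below is the set of relations of any of its representatives.\<close>

definition marked_relations :: "nat \<Rightarrow> 'g marked_group set \<Rightarrow> nat gword set" where
  "marked_relations k C = (\<Inter>(G, S)\<in>C. {w \<in> words {..<k}. word_value G S w = \<one>\<^bsub>G\<^esub>})"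

definition same_relations ::
  "nat \<Rightarrow> nat \<Rightarrow> 'g marked_group set \<Rightarrow> 'g marked_group set \<Rightarrow> bool" where
  "same_relations k R C D \<longleftrightarrow>
     (\<forall>w. length w \<le> R \<longrightarrow> (w \<in> marked_relations k C \<longleftrightarrow> w \<in> marked_relations k D))"

definition marked_dist :: "nat \<Rightarrow> 'g marked_group set \<Rightarrow> 'g marked_group set \<Rightarrow> real" where
  "marked_dist k C D = Inf {exp (- real R) | R. same_relations k R C D}"

definition marked_topology :: "nat \<Rightarrow> 'g marked_group set topology" where
  "marked_topology k = Metric_space.mtopology (marked_space k) (marked_dist k)"

text \<open>The isomorphism class of \<open>\<langle>x\<^sub>0, \<dots>, x\<^sub>k\<^sub>-\<^sub>1 | R\<rangle>\<close>, marked by its generators.\<close>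

definition marked_presentation :: "nat \<Rightarrow> nat gword set \<Rightarrow> nat gword set set marked_group set" where
  "marked_presentation k R =
     marked_class k (presented_group {..<k} R, map (presented_gen {..<k} R) [0..<k])"


section \<open>Thompson's group\<close>

text \<open>Homeomorphisms of \<open>[0,1]\<close> are represented by functions on the reals that are the identity
  outside \<open>[0,1]\<close>.  The finite set \<open>B\<close> contains all breakpoints.\<close>

definition thompson_maps :: "(real \<Rightarrow> real) set" where
  "thompson_maps = {f. (\<forall>t. t \<notin> {0..1} \<longrightarrow> f t = t) \<and>
     (\<exists>h. homeomorphism {0..1} {0..1} f h) \<and> strict_mono_on {0..1} f \<and>
     (\<exists>B \<subseteq> dyadics. finite B \<and>
        (\<forall>u v. 0 \<le> u \<and> u < v \<and> v \<le> 1 \<and> {u<..<v} \<inter> B = {} \<longrightarrow>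
           (\<exists>(k::int) c. \<forall>t\<in>{u..v}. f t = 2 powi k * t + c)))}"

definition thompson_F :: "(real \<Rightarrow> real) monoid" where
  "thompson_F = \<lparr>carrier = thompson_maps, mult = (\<circ>), one = id\<rparr>"

definition supp :: "(real \<Rightarrow> real) \<Rightarrow> real set" where
  "supp f = closure {t. f t \<noteq> t}"

definition x0 :: "real \<Rightarrow> real" where
  "x0 t = (if t \<in> {0..1/2} then t / 2
           else if t \<in> {1/2..3/4} then t - 1/4
           else if t \<in> {3/4..1} then 2 * t - 1
           else t)"

definition x1 :: "real \<Rightarrow> real" where
  "x1 t = (if t \<in> {1/2..1} then 1/2 + 1/2 * x0 (2 * t - 1) else t)"


section \<open>The presentations\<close>

abbreviation ga :: "nat gword" where "ga \<equiv> gen 0"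
abbreviation gb :: "nat gword" where "gb \<equiv> gen 1"
abbreviation gc :: "nat gword" where "gc \<equiv> gen 2"

definition R1 :: "nat gword" where
  "R1 = wcomm (gb @ winv ga) (winv ga @ gb @ ga)"

definition R2 :: "nat gword" where
  "R2 = wcomm (gb @ winv ga) (wpow ga (-2) @ gb @ wpow ga 2)"


section \<open>The definitions are meaningful\<close>

text \<open>The classes of marked groups form a metric space, and every presentation on \<open>k\<close> generators
  defines a point of it.\<close>

lemma equiv_marked_iso_rel: "equiv (marked_groups k :: 'a marked_group set) (marked_iso_rel k)"
  (is "equiv ?A ?r")
proof (rule equivI)
  show "?r \<subseteq> ?A \<times> ?A"
    by (auto simp: marked_iso_rel_def)
  show "refl_on ?A ?r"
  proof (rule refl_onI)
    fix M :: "'a marked_group" assume "M \<in> marked_groups k"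
    moreover obtain G S where e: "M = (G, S)" by force
    moreover have "(\<lambda>x. x) \<in> iso G G" by (simp add: iso_def hom_def bij_betw_def)
    ultimately show "(M, M) \<in> marked_iso_rel k"
      by (auto simp: marked_iso_rel_def e intro!: bexI[of _ "\<lambda>x. x"])
  qed
  show "sym ?r"
  proof (rule symI)
    fix M N :: "'a marked_group" assume MN: "(M, N) \<in> marked_iso_rel k"
    obtain G S H T where e: "M = (G, S)" "N = (H, T)" by (meson surj_pair)
    with MN obtain h where h: "h \<in> iso G H" "map h S = T" "M \<in> marked_groups k" "N \<in> marked_groups k"
      by (auto simp: marked_iso_rel_def)
    then have G: "group G" and S: "set S \<subseteq> carrier G" by (auto simp: marked_groups_def e)
    let ?h = "inv_into (carrier G) h"
    have "?h \<in> iso H G" using h(1) G by (simp add: group.iso_set_sym)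
    moreover have "map ?h T = S"
    proof -
      have "inj_on h (carrier G)" using h(1) by (auto simp: iso_def bij_betw_def)
      then show ?thesis using h(2) S by (auto simp: subset_iff intro!: map_idI)
    qed
    ultimately show "(N, M) \<in> marked_iso_rel k"
      using h(3,4) e unfolding marked_iso_rel_def by blast
  qed
  show "trans ?r"
  proof (rule transI)
    fix L M N :: "'a marked_group"
    assume a: "(L, M) \<in> marked_iso_rel k" "(M, N) \<in> marked_iso_rel k"
    obtain G S H T K U where e: "L = (G, S)" "M = (H, T)" "N = (K, U)" by (meson surj_pair)
    from a e obtain h i where h: "h \<in> iso G H" "map h S = T" "i \<in> iso H K" "map i T = U"
       and m: "L \<in> marked_groups k" "N \<in> marked_groups k"
      by (auto simp: marked_iso_rel_def)
    have "i \<circ> h \<in> iso G K" using h iso_set_trans by blast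
    moreover have "map (i \<circ> h) S = U" using h by auto
    ultimately show "(L, N) \<in> marked_iso_rel k" using m e unfolding marked_iso_rel_def by blast
  qed
qed

lemma word_value_Nil [simp]: "word_value G S [] = \<one>\<^bsub>G\<^esub>"
  and word_value_Cons [simp]: "word_value G S (l # w) = letter_value G S l \<otimes>\<^bsub>G\<^esub> word_value G S w"
  by (simp_all add: word_value_def)

lemma words_Nil [simp]: "[] \<in> words X"
  and words_Cons [simp]: "l # w \<in> words X \<longleftrightarrow> fst l \<in> X \<and> w \<in> words X"
  and words_append [simp]: "u @ v \<in> words X \<longleftrightarrow> u \<in> words X \<and> v \<in> words X"
  by (cases l; auto simp: words_def)+

lemma winv_Nil [simp]: "winv [] = []"
  and winv_append: "winv (u @ v) = winv v @ winv u"
  and winv_Cons: "winv (l # v) = winv v @ [(fst l, \<not> snd l)]"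
  by (auto simp: winv_def split: prod.split)

lemma winv_words [simp]: "winv w \<in> words X \<longleftrightarrow> w \<in> words X"
  by (induction w) (auto simp: winv_Cons)

context
  fixes k :: nat and G :: "'g monoid" and S
  assumes GS: "(G, S) \<in> marked_groups k"
begin

interpretation group G using GS by (simp add: marked_groups_def)

lemma nth_marking_closed: "i < k \<Longrightarrow> S ! i \<in> carrier G"
  using GS by (auto simp: marked_groups_def subset_iff)

lemma letter_value_closed: "fst l < k \<Longrightarrow> letter_value G S l \<in> carrier G"
  by (simp add: letter_value_def nth_marking_closed)

lemma word_value_closed: "w \<in> words {..<k} \<Longrightarrow> word_value G S w \<in> carrier G"
  by (induction w) (auto simp: letter_value_closed)

lemma word_value_append:
  "u \<in> words {..<k} \<Longrightarrow> v \<in> words {..<k} \<Longrightarrow>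
   word_value G S (u @ v) = word_value G S u \<otimes>\<^bsub>G\<^esub> word_value G S v"
  by (induction u) (auto simp: letter_value_closed word_value_closed m_assoc)

lemma word_value_winv:
  "u \<in> words {..<k} \<Longrightarrow> word_value G S (winv u) = inv\<^bsub>G\<^esub> (word_value G S u)"
  by (induction u)
     (auto simp: word_value_append winv_Cons letter_value_closed word_value_closed inv_mult_group
        letter_value_def nth_marking_closed)

lemma word_value_surj: "x \<in> carrier G \<Longrightarrow> \<exists>w \<in> words {..<k}. word_value G S w = x"
proof -
  assume "x \<in> carrier G"
  then have "x \<in> generate G (set S)" using GS by (simp add: marked_groups_def)
  then show ?thesis
  proof (induction rule: generate.induct)
    case one
    show ?case by (rule bexI[of _ "[]"]) auto
  next
    case (incl h)
    then obtain i where "i < k" "S ! i = h" using GS by (auto simp: in_set_conv_nth marked_groups_def)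
    then show ?case
      by (intro bexI[of _ "[(i, True)]"]) (auto simp: letter_value_def nth_marking_closed)
  next
    case (inv h)
    then obtain i where "i < k" "S ! i = h" using GS by (auto simp: in_set_conv_nth marked_groups_def)
    then show ?case
      by (intro bexI[of _ "[(i, False)]"]) (auto simp: letter_value_def nth_marking_closed)
  next
    case (eng h1 h2)
    then obtain u v where "u \<in> words {..<k}" "v \<in> words {..<k}" "word_value G S u = h1" "word_value G S v = h2"
      by blast
    then show ?case by (intro bexI[of _ "u @ v"]) (auto simp: word_value_append)
  qed
qed

end

lemma word_value_iso:
  assumes "(G, S) \<in> marked_groups k" "(H, T) \<in> marked_groups k" "h \<in> iso G H" "map h S = T"
    and "w \<in> words {..<k}"
  shows "word_value H T w = h (word_value G S w)"
proof -
  interpret G: group G using assms by (simp add: marked_groups_def)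
  interpret H: group H using assms by (simp add: marked_groups_def)
  have hom: "h \<in> hom G H" using assms by (simp add: iso_def)
  then interpret group_hom G H h by unfold_locales
  have len: "length S = k" using assms by (simp add: marked_groups_def)
  have "letter_value H T l = h (letter_value G S l)" if "fst l < k" for l
    using that assms(4) len nth_marking_closed[OF assms(1)] by (auto simp: letter_value_def)
  then show ?thesis using assms(5)
    by (induction w) (auto simp: letter_value_closed[OF assms(1)] word_value_closed[OF assms(1)])
qed

lemma marked_relations_eq:
  assumes "C \<in> marked_space k" "(G, S) \<in> C"
  shows "marked_relations k C = {w \<in> words {..<k}. word_value G S w = \<one>\<^bsub>G\<^esub>}"
proof -
  have "word_value H T w = \<one>\<^bsub>H\<^esub>"
    if "(H, T) \<in> C" "w \<in> words {..<k}" "word_value G S w = \<one>\<^bsub>G\<^esub>" for H T w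
  proof -
    have "((G, S), (H, T)) \<in> marked_iso_rel k"
      using assms that(1) equiv_marked_iso_rel unfolding marked_space_def
      by (meson quotient_eq_iff)
    then obtain h where h: "(G, S) \<in> marked_groups k" "(H, T) \<in> marked_groups k" "h \<in> iso G H" "map h S = T"
      by (auto simp: marked_iso_rel_def)
    then have "group G" "group H" "h \<in> hom G H" by (auto simp: marked_groups_def iso_def)
    then have "h \<one>\<^bsub>G\<^esub> = \<one>\<^bsub>H\<^esub>" by (simp add: hom_one)
    with that word_value_iso[OF h] show ?thesis by simp
  qed
  then show ?thesis using assms(2) unfolding marked_relations_def by fastforce
qed

lemma marked_relations_inject:
  fixes C D :: "'g marked_group set"
  assumes C: "C \<in> marked_space k" and D: "D \<in> marked_space k"
    and eq: "marked_relations k C = marked_relations k D"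
  shows "C = D"
proof -
  obtain G S where GS: "(G, S) \<in> C" "(G, S) \<in> marked_groups k"
    using C equiv_marked_iso_rel[of k] unfolding marked_space_def
    by (metis quotientE equiv_class_self surj_pair)
  obtain H T where HT: "(H, T) \<in> D" "(H, T) \<in> marked_groups k"
    using D equiv_marked_iso_rel[of k] unfolding marked_space_def
    by (metis quotientE equiv_class_self surj_pair)
  interpret G: group G using GS by (simp add: marked_groups_def)
  interpret H: group H using HT by (simp add: marked_groups_def)
  let ?W = "words {..<k}" and ?f = "word_value G S" and ?g = "word_value H T"
  have triv: "?f w = \<one>\<^bsub>G\<^esub> \<longleftrightarrow> ?g w = \<one>\<^bsub>H\<^esub>" if "w \<in> ?W" for w
    using eq that marked_relations_eq[OF C GS(1)] marked_relations_eq[OF D HT(1)] by blast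
  have same: "?f u = ?f v \<longleftrightarrow> ?g u = ?g v" if "u \<in> ?W" "v \<in> ?W" for u v
  proof -
    have "?f (u @ winv v) = ?f u \<otimes>\<^bsub>G\<^esub> inv\<^bsub>G\<^esub> ?f v" "?g (u @ winv v) = ?g u \<otimes>\<^bsub>H\<^esub> inv\<^bsub>H\<^esub> ?g v"
      using that by (simp_all add: word_value_append[OF GS(2)] word_value_winv[OF GS(2)]
          word_value_append[OF HT(2)] word_value_winv[OF HT(2)])
    moreover have "?f u \<otimes>\<^bsub>G\<^esub> inv\<^bsub>G\<^esub> ?f v = \<one>\<^bsub>G\<^esub> \<longleftrightarrow> ?f u = ?f v"
      by (metis G.inv_closed G.inv_equality G.inv_inv G.r_inv that word_value_closed[OF GS(2)])
    moreover have "?g u \<otimes>\<^bsub>H\<^esub> inv\<^bsub>H\<^esub> ?g v = \<one>\<^bsub>H\<^esub> \<longleftrightarrow> ?g u = ?g v"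
      by (metis H.inv_closed H.inv_equality H.inv_inv H.r_inv that word_value_closed[OF HT(2)])
    ultimately show ?thesis using triv[of "u @ winv v"] that by simp
  qed
  define h where "h = (\<lambda>x. ?g (SOME w. w \<in> ?W \<and> ?f w = x))"
  have h: "h (?f w) = ?g w" if "w \<in> ?W" for w
  proof -
    let ?v = "SOME v. v \<in> ?W \<and> ?f v = ?f w"
    have "?v \<in> ?W \<and> ?f ?v = ?f w" by (rule someI[of _ w]) (use that in auto)
    then show ?thesis using same that unfolding h_def by blast
  qed
  have "h \<in> iso G H"
    unfolding iso_def
  proof (intro CollectI conjI homI bij_betwI')
    fix x assume "x \<in> carrier G"
    then obtain u where u: "u \<in> ?W" "x = ?f u" using word_value_surj[OF GS(2)] by metis
    then show "h x \<in> carrier H" by (simp add: h word_value_closed[OF HT(2)])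
    then show "h x \<in> carrier H" .
    fix y assume "y \<in> carrier G"
    then obtain v where v: "v \<in> ?W" "y = ?f v" using word_value_surj[OF GS(2)] by metis
    show "h x = h y \<longleftrightarrow> x = y" using u v same h by simp
    have "x \<otimes>\<^bsub>G\<^esub> y = ?f (u @ v)" using u v by (simp add: word_value_append[OF GS(2)])
    then show "h (x \<otimes>\<^bsub>G\<^esub> y) = h x \<otimes>\<^bsub>H\<^esub> h y"
      using u v h[of "u @ v"] by (simp add: h word_value_append[OF HT(2)])
  next
    fix y assume "y \<in> carrier H"
    then obtain v where "v \<in> ?W" "y = ?g v" using word_value_surj[OF HT(2)] by metis
    then show "\<exists>x\<in>carrier G. y = h x" using h word_value_closed[OF GS(2)] by metis
  qed
  moreover have "map h S = T"
  proof (rule nth_equalityI)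
    show "length (map h S) = length T" using GS HT by (simp add: marked_groups_def)
    fix i assume "i < length (map h S)"
    then have i: "i < k" "i < length S" using GS by (auto simp: marked_groups_def)
    have "?f [(i, True)] = S ! i" "?g [(i, True)] = T ! i"
      using i nth_marking_closed[OF GS(2)] nth_marking_closed[OF HT(2)] by (auto simp: letter_value_def)
    then show "map h S ! i = T ! i" using h[of "[(i, True)]"] i by simp
  qed
  ultimately have "((G, S), (H, T)) \<in> marked_iso_rel k"
    using GS HT unfolding marked_iso_rel_def by blast
  then show ?thesis
    using C D GS HT equiv_marked_iso_rel unfolding marked_space_def by (metis quotient_eqI)
qed

lemma marked_dist_le_iff: "marked_dist k C D \<le> exp (- real R) \<longleftrightarrow> same_relations k R C D"
proof -
  let ?E = "{exp (- real R) | R. same_relations k R C D}"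
  have bdd: "bdd_below ?E" by (rule bdd_belowI[of _ 0]) auto
  have "same_relations k 0 C D" by (auto simp: same_relations_def marked_relations_def)
  then have ne: "?E \<noteq> {}" by blast
  show ?thesis
  proof
    assume "marked_dist k C D \<le> exp (- real R)"
    then have "Inf ?E < exp (1 - real R)"
      unfolding marked_dist_def by (smt (verit, ccfv_threshold) exp_less_cancel_iff)
    then obtain Q where "same_relations k Q C D" "exp (- real Q) < exp (1 - real R)"
      using cInf_less_iff[OF ne bdd] by auto
    then have "same_relations k Q C D" "R \<le> Q" by auto
    then show "same_relations k R C D" by (auto simp: same_relations_def)
  next
    assume "same_relations k R C D"
    then show "marked_dist k C D \<le> exp (- real R)"
      unfolding marked_dist_def by (intro cInf_lower[OF _ bdd]) blast
  qed
qed

lemma Metric_space_marked_space: "Metric_space (marked_space k) (marked_dist k)"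
proof
  have zero_le: "0 \<le> marked_dist k C D" for C D :: "'a marked_group set"
  proof -
    have "same_relations k 0 C D" by (auto simp: same_relations_def marked_relations_def)
    then show ?thesis unfolding marked_dist_def by (intro cInf_greatest) auto
  qed
  fix C D E :: "'a marked_group set"
  show "0 \<le> marked_dist k C D" by (rule zero_le)
  show "marked_dist k C D = marked_dist k D C"
    unfolding marked_dist_def same_relations_def by (simp add: eq_commute)
  {
    assume C: "C \<in> marked_space k" and D: "D \<in> marked_space k"
    show "marked_dist k C D = 0 \<longleftrightarrow> C = D"
    proof
      assume "marked_dist k C D = 0"
      then have "same_relations k R C D" for R using marked_dist_le_iff[of k C D R] by simp
      then have "marked_relations k C = marked_relations k D" unfolding same_relations_def by blast
      then show "C = D" using marked_relations_inject C D by blast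
    next
      assume "C = D"
      then have le: "marked_dist k C D \<le> exp (- real R)" for R
        by (simp add: marked_dist_le_iff same_relations_def)
      have "(\<lambda>R. exp (- real R)) \<longlonglongrightarrow> 0"
        by real_asymp
      then have "marked_dist k C D \<le> 0" using le by (meson LIMSEQ_le_const)
      then show "marked_dist k C D = 0" using zero_le[of C D] by linarith
    qed
  }
  show "marked_dist k C E \<le> marked_dist k C D + marked_dist k D E"
  proof (rule ccontr)
    assume n: "\<not> ?thesis"
    let ?I = "\<lambda>C D. {exp (- real R) | R. same_relations k R C D}"
    have ne: "?I C D \<noteq> {}" for C D :: "'a marked_group set"
      using same_relations_def marked_relations_def by (auto intro!: exI[of _ 0] simp: same_relations_def marked_relations_def)
    have bdd: "bdd_below (?I C D)" for C D :: "'a marked_group set" by (rule bdd_belowI[of _ 0]) auto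
    have "marked_dist k C D < marked_dist k C E" "marked_dist k D E < marked_dist k C E"
      using n zero_le[of C D] zero_le[of D E] by linarith+
    then have "Inf (?I C D) < marked_dist k C E" "Inf (?I D E) < marked_dist k C E"
      by (simp_all add: marked_dist_def)
    then obtain p q where "p \<in> ?I C D" "p < marked_dist k C E" "q \<in> ?I D E" "q < marked_dist k C E"
      unfolding cInf_less_iff[OF ne bdd] by blast
    then obtain P Q where P: "same_relations k P C D" "exp (- real P) < marked_dist k C E"
      and Q: "same_relations k Q D E" "exp (- real Q) < marked_dist k C E"
      by blast
    from P(1) Q(1) have "same_relations k (min P Q) C E" by (auto simp: same_relations_def)
    then have "marked_dist k C E \<le> exp (- real (min P Q))" by (simp add: marked_dist_le_iff)
    then show False using P(2) Q(2) by (auto simp: min_def split: if_splits)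
  qed
qed

lemma cancels_append: "cancels u v \<Longrightarrow> cancels (p @ u @ q) (p @ v @ q)"
proof (induction rule: cancels.induct)
  case (1 u x e v)
  show ?case using cancels.intros[of "p @ u" x e "v @ q"] by simp
qed

lemma equivclp_cancels_append: "equivclp cancels u v \<Longrightarrow> equivclp cancels (p @ u @ q) (p @ v @ q)"
proof (induction rule: equivclp_induct)
  case (step y z)
  then have "cancels (p @ y @ q) (p @ z @ q) \<or> cancels (p @ z @ q) (p @ y @ q)"
    using cancels_append by blast
  then show ?case using step.IH by (meson equivclp_into_equivclp)
qed auto

lemma equivclp_cancels_winv: "equivclp cancels (winv w @ w) []"
proof (induction w)
  case (Cons l w)
  obtain x e where l: "l = (x, e)" by force
  have "cancels (winv w @ [(x, \<not> e), (x, \<not> \<not> e)] @ w) (winv w @ w)" by (rule cancels.intros)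
  then have "cancels (winv (l # w) @ l # w) (winv w @ w)" by (simp add: winv_Cons l)
  then show ?case using Cons by (meson equivclp_trans r_into_equivclp)
qed simp

lemma equiv_free_rel: "equiv (words X) (free_rel X)"
  by (rule equivI)
     (auto simp: free_rel_def refl_on_def sym_def trans_def intro: equivclp_sym equivclp_trans)

lemma free_class_eq_iff:
  "u \<in> words X \<Longrightarrow> v \<in> words X \<Longrightarrow> free_class X u = free_class X v \<longleftrightarrow> equivclp cancels u v"
  using eq_equiv_class_iff[OF equiv_free_rel, of u X v] by (simp add: free_class_def free_rel_def)

lemma free_class_in_carrier: "u \<in> words X \<Longrightarrow> free_class X u \<in> carrier (free_group X)"
  by (simp add: free_group_def free_class_def quotientI)

lemma carrier_free_group: "carrier (free_group X) = free_class X ` words X"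
  by (auto simp: free_group_def free_class_def quotient_def)

lemma one_free_group: "\<one>\<^bsub>free_group X\<^esub> = free_class X []"
  by (simp add: free_group_def)

lemma mult_free_group:
  assumes "u \<in> words X" "v \<in> words X"
  shows "free_class X u \<otimes>\<^bsub>free_group X\<^esub> free_class X v = free_class X (u @ v)"
proof -
  have "free_class X (p @ q) = free_class X (u @ v)" if "p \<in> free_class X u" "q \<in> free_class X v" for p q
  proof -
    have pq: "p \<in> words X" "q \<in> words X" "equivclp cancels u p" "equivclp cancels v q"
      using that by (auto simp: free_class_def free_rel_def)
    have "equivclp cancels (u @ v) (p @ v)" "equivclp cancels (p @ v) (p @ q)"
      using equivclp_cancels_append[OF pq(3), of "[]" v] equivclp_cancels_append[OF pq(4), of p "[]"] by simp_all
    then have "equivclp cancels (u @ v) (p @ q)" by (rule equivclp_trans)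
    moreover have "u @ v \<in> words X" "p @ q \<in> words X" using assms pq(1,2) by simp_all
    ultimately show ?thesis by (metis free_class_eq_iff)
  qed
  moreover have "u \<in> free_class X u" "v \<in> free_class X v"
    using assms by (simp_all add: free_class_def free_rel_def)
  ultimately have "(\<Union>p\<in>free_class X u. \<Union>q\<in>free_class X v. free_class X (p @ q)) = free_class X (u @ v)"
    by blast
  then show ?thesis by (simp add: free_group_def)
qed

lemma group_free_group: "group (free_group X)"
proof (rule groupI)
  fix x assume "x \<in> carrier (free_group X)"
  then obtain u where u: "u \<in> words X" "x = free_class X u" by (auto simp: carrier_free_group)
  have "free_class X (winv u) \<otimes>\<^bsub>free_group X\<^esub> x = \<one>\<^bsub>free_group X\<^esub>"
    using u equivclp_cancels_winv[of u] by (simp add: mult_free_group one_free_group free_class_eq_iff)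
  then show "\<exists>y\<in>carrier (free_group X). y \<otimes>\<^bsub>free_group X\<^esub> x = \<one>\<^bsub>free_group X\<^esub>"
    using u free_class_in_carrier by (metis winv_words)
qed (auto simp: carrier_free_group one_free_group mult_free_group)

lemma normal_closure_normal:
  assumes "group G" "A \<subseteq> carrier G"
  shows "normal_closure G A \<lhd> G"
proof -
  interpret group G by fact
  have "carrier G \<lhd> G"
    by (auto simp: normal_inv_iff subgroup_self)
  then have ne: "{N. N \<lhd> G \<and> A \<subseteq> N} \<noteq> {}" using assms(2) by blast
  have "subgroup (\<Inter> {N. N \<lhd> G \<and> A \<subseteq> N}) G"
    by (rule subgroups_Inter[OF _ ne]) (auto simp: normal_inv_iff)
  then show ?thesis
    unfolding normal_closure_def by (subst normal_inv_iff) (auto simp: normal_inv_iff)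
qed

lemma relator_closure_normal:
  "R \<subseteq> words X \<Longrightarrow> relator_closure X R \<lhd> free_group X"
  unfolding relator_closure_def
  by (intro normal_closure_normal group_free_group) (auto simp: carrier_free_group)

lemma presented_marked_group:
  assumes "R \<subseteq> words {..<k}"
  shows "(presented_group {..<k} R, map (presented_gen {..<k} R) [0..<k]) \<in> marked_groups k"
proof -
  let ?F = "free_group {..<k}" and ?N = "relator_closure {..<k} R" and ?P = "presented_group {..<k} R"
  let ?S = "map (presented_gen {..<k} R) [0..<k]"
  interpret N: normal ?N ?F using relator_closure_normal[OF assms] .
  let ?q = "\<lambda>w. ?N #>\<^bsub>?F\<^esub> free_class {..<k} w"
  have grp: "group ?P" unfolding presented_group_def by (rule N.factorgroup_is_group)
  interpret P: group ?P by (rule grp)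
  have hom: "?q (u @ v) = ?q u \<otimes>\<^bsub>?P\<^esub> ?q v" if "u \<in> words {..<k}" "v \<in> words {..<k}" for u v
    using that by (simp add: presented_group_def N.rcos_sum free_class_in_carrier mult_free_group)
  have carr: "carrier ?P = ?q ` words {..<k}"
    by (auto simp: presented_group_def FactGroup_def RCOSETS_def carrier_free_group)
  have S: "set ?S \<subseteq> carrier ?P"
    by (auto simp: carr presented_gen_def gen_def intro!: imageI)
  have one: "?q [] = \<one>\<^bsub>?P\<^esub>"
  proof -
    have "?q [] \<in> carrier ?P" unfolding carr by (rule imageI) simp
    then show ?thesis using hom[of "[]" "[]"] P.r_cancel_one'[of "?q []" "?q []"] by (metis append_Nil words_Nil)
  qed
  have "?q w \<in> generate ?P (set ?S)" if "w \<in> words {..<k}" for w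
    using that
  proof (induction w)
    case Nil
    show ?case by (simp add: one generate.one)
  next
    case (Cons l w)
    obtain x e where l: "l = (x, e)" by force
    with Cons have x: "x < k" by simp
    have g: "?q [(x, True)] \<in> set ?S" using x by (auto simp: presented_gen_def gen_def)
    have "equivclp cancels (winv [(x, True)] @ [(x, True)]) []" by (rule equivclp_cancels_winv)
    then have "free_class {..<k} [(x, False), (x, True)] = free_class {..<k} []"
      using x by (simp add: free_class_eq_iff winv_Cons)
    then have "?q [(x, False)] \<otimes>\<^bsub>?P\<^esub> ?q [(x, True)] = \<one>\<^bsub>?P\<^esub>"
      using hom[of "[(x, False)]" "[(x, True)]"] one x by simp
    then have "?q [(x, False)] = inv\<^bsub>?P\<^esub> (?q [(x, True)])"
    proof (intro P.inv_equality[symmetric])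
      show "?q [(x, True)] \<in> carrier ?P" "?q [(x, False)] \<in> carrier ?P"
        unfolding carr by (rule imageI; use x in simp)+
    qed
    then have "?q [l] \<in> generate ?P (set ?S)"
      using generate.incl[OF g, of ?P] generate.inv[OF g, of ?P] unfolding l by (cases e) metis+
    moreover have "?q (l # w) = ?q [l] \<otimes>\<^bsub>?P\<^esub> ?q w" using hom[of "[l]" w] Cons.prems by (metis append_Cons append_Nil words_Cons words_Nil)
    ultimately show ?case using Cons by (metis generate.eng words_Cons)
  qed
  then have "carrier ?P \<subseteq> generate ?P (set ?S)" by (auto simp: carr)
  then have "generate ?P (set ?S) = carrier ?P" using P.generate_incl[OF S] by blast
  then show ?thesis using grp S by (simp add: marked_groups_def)
qed

lemma marked_presentation_in_space:
  "R \<subseteq> words {..<k} \<Longrightarrow> marked_presentation k R \<in> marked_space k"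
  unfolding marked_presentation_def marked_class_def marked_space_def
  by (intro quotientI presented_marked_group)

end

theory Submission
  imports Defs
begin

text \<open>
  All groups that occur are compared with subgroups of the group of order automorphisms of the line.

  In a group with elements \<open>a\<close>, \<open>b\<close> satisfying \<open>R\<^sub>1\<close>, \<open>R\<^sub>2\<close>, the elements \<open>X\<^sub>0 = a\<close>,
  \<open>X\<^sub>n\<^sub>+\<^sub>1 = a\<^sup>-\<^sup>n b a\<^sup>n\<close> satisfy \<open>X\<^sub>n X\<^sub>k = X\<^sub>k X\<^sub>n\<^sub>+\<^sub>1\<close> for \<open>k < n\<close>, so that every word in \<open>a\<close>, \<open>b\<close>
  is a quotient of two positive words in the \<open>X\<^sub>n\<close>.  The homeomorphism given by a positive word
  determines the least index occurring in it, and this letter can be moved to the front and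
  cancelled.  Hence a word in \<open>a\<close>, \<open>b\<close> that is trivial in Thompson's group follows from \<open>R\<^sub>1\<close>, \<open>R\<^sub>2\<close>,
  and the relations of \<open>G\<^sub>n\<close> are those of \<open>(x\<^sub>0, x\<^sub>1, g\<^sub>n)\<close>.

  Since \<open>x\<^sub>0\<close> halves near \<open>0\<close>, the translates of \<open>[r\<^sub>n, s\<^sub>n]\<close> under its powers are disjoint, so each
  relator of \<open>G\<close> holds in \<open>G\<^sub>n\<close> for large \<open>n\<close>.  Conversely, an element of \<open>G\<close> is a product of
  conjugates \<open>a\<^sup>i c\<^sup>\<plusminus>\<^sup>1 a\<^sup>-\<^sup>i\<close> and a word \<open>h\<close> in \<open>a\<close>, \<open>b\<close>.  If it is trivial in \<open>G\<^sub>n\<close> for infinitely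
  many \<open>n\<close>, then \<open>h\<close> is supported arbitrarily close to \<open>0\<close>, hence trivial, and the exponents of
  each conjugate cancel because \<open>g\<^sub>n\<close> has infinite order.
\<close>

section \<open>Values of words\<close>

lemma words_mono: "w \<in> words X \<Longrightarrow> X \<subseteq> Y \<Longrightarrow> w \<in> words Y"
  by (induction w) auto

lemma wpow_words [simp]: "u \<in> words X \<Longrightarrow> wpow u i \<in> words X"
proof -
  have "v \<in> words X \<Longrightarrow> concat (replicate n v) \<in> words X" for v :: "'a gword" and n
    by (induction n) auto
  then show "u \<in> words X \<Longrightarrow> wpow u i \<in> words X" by (simp add: wpow_def)
qed

lemma wconj_words [simp]: "u \<in> words X \<Longrightarrow> v \<in> words X \<Longrightarrow> wconj u v \<in> words X"
  by (simp add: wconj_def)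

lemma wcomm_words [simp]: "u \<in> words X \<Longrightarrow> v \<in> words X \<Longrightarrow> wcomm u v \<in> words X"
  by (simp add: wcomm_def)

lemma gen_words [simp]: "gen x \<in> words X \<longleftrightarrow> x \<in> X"
  by (simp add: gen_def)

lemma R1_words: "{0, 1} \<subseteq> X \<Longrightarrow> R1 \<in> words X"
  and R2_words: "{0, 1} \<subseteq> X \<Longrightarrow> R2 \<in> words X"
  by (simp_all add: R1_def R2_def)

text \<open>Lets words in \<open>a\<close> and \<open>b\<close> be evaluated alike at markings of
  length two and three.\<close>

lemma word_value_prefix:
  "w \<in> words {..<length S} \<Longrightarrow> word_value G (S @ T) w = word_value G S w"
  by (induction w) (auto simp: letter_value_def nth_append)

locale marking = group G for G (structure) +
  fixes S :: "'a list"
  assumes marking_closed: "set S \<subseteq> carrier G"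
begin

lemma nth_closed [simp]: "i < length S \<Longrightarrow> S ! i \<in> carrier G"
  using marking_closed by auto

lemma letter_closed [simp]: "fst l < length S \<Longrightarrow> letter_value G S l \<in> carrier G"
  by (simp add: letter_value_def)

lemma val_closed [simp]: "w \<in> words {..<length S} \<Longrightarrow> word_value G S w \<in> carrier G"
  by (induction w) auto

lemma val_append:
  "u \<in> words {..<length S} \<Longrightarrow> v \<in> words {..<length S} \<Longrightarrow>
   word_value G S (u @ v) = word_value G S u \<otimes> word_value G S v"
  by (induction u) (auto simp: m_assoc)

lemma val_gen [simp]: "i < length S \<Longrightarrow> word_value G S (gen i) = S ! i"
  by (simp add: gen_def letter_value_def)

lemma val_winv:
  "u \<in> words {..<length S} \<Longrightarrow> word_value G S (winv u) = inv (word_value G S u)"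
  by (induction u) (auto simp: val_append winv_Cons inv_mult_group letter_value_def)

lemma val_wpow:
  assumes "u \<in> words {..<length S}"
  shows "word_value G S (wpow u i) = word_value G S u [^] i"
proof -
  have *: "word_value G S (concat (replicate n v)) = word_value G S v [^] n"
    if "v \<in> words {..<length S}" for v n
  proof (induction n)
    case (Suc n)
    have "concat (replicate n v) \<in> words {..<length S}"
      using that by (induction n) auto
    then show ?case
      using Suc that nat_pow_Suc2[of "word_value G S v" n] by (simp add: val_append)
  qed simp
  show ?thesis
  proof (cases i rule: int_cases2)
    case (nonneg n)
    then have "wpow u i = concat (replicate n u)" by (simp add: wpow_def)
    then show ?thesis using *[OF assms] by (simp only: nonneg int_pow_int)
  next
    case (nonpos n)
    then have "wpow u i = concat (replicate n (winv u))" by (auto simp: wpow_def)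
    moreover have "winv u \<in> words {..<length S}" using assms by simp
    ultimately show ?thesis
      using *[of "winv u" n] val_closed[OF assms]
      by (simp only: nonpos int_pow_neg_int val_winv[OF assms] nat_pow_inv)
  qed
qed

lemma val_wconj:
  assumes "u \<in> words {..<length S}" "v \<in> words {..<length S}"
  shows "word_value G S (wconj u v) =
           word_value G S u \<otimes> word_value G S v \<otimes> inv (word_value G S u)"
  using assms by (simp add: wconj_def val_append val_winv m_assoc)

lemma val_wcomm_eq_one_iff:
  assumes "u \<in> words {..<length S}" "v \<in> words {..<length S}"
  shows "word_value G S (wcomm u v) = \<one> \<longleftrightarrow>
           word_value G S u \<otimes> word_value G S v = word_value G S v \<otimes> word_value G S u"
proof -
  let ?x = "word_value G S u" and ?y = "word_value G S v"
  have "word_value G S (wcomm u v) = (?x \<otimes> ?y) \<otimes> inv (?y \<otimes> ?x)"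
    using assms by (simp add: wcomm_def val_append val_winv m_assoc inv_mult_group)
  moreover have "p \<otimes> inv q = \<one> \<longleftrightarrow> p = q" if "p \<in> carrier G" "q \<in> carrier G" for p q
    using that by (metis inv_closed inv_equality inv_inv r_inv)
  ultimately show ?thesis using assms by simp
qed

text \<open>Two equivalent words over \<open>X\<close> may be joined through words that use letters outside \<open>X\<close>,
  hence the filter.\<close>

lemma val_filter_equivclp:
  assumes "equivclp cancels u v"
  defines "p \<equiv> filter (\<lambda>l. fst l < length S)"
  shows "word_value G S (p u) = word_value G S (p v)"
proof -
  have p: "p w \<in> words {..<length S}" for w
    unfolding p_def by (induction w) auto
  have *: "word_value G S (p u) = word_value G S (p v)" if "cancels u v" for u v
    using that
  proof (cases rule: cancels.cases)
    case (1 u x e v)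
    have pa: "p (u @ v) = p u @ p v" for u v by (simp add: p_def)
    have "word_value G S (p [(x, e), (x, \<not> e)]) = \<one>"
      by (cases e) (auto simp: p_def letter_value_def)
    then show ?thesis unfolding 1 by (simp only: pa val_append p words_append val_closed) (simp add: p)
  qed
  show ?thesis using assms(1)
    by (induction rule: equivclp_induct) (auto dest: *)
qed

lemma val_free_class:
  assumes "u \<in> words {..<length S}" "v \<in> words {..<length S}"
    and "free_class {..<length S} u = free_class {..<length S} v"
  shows "word_value G S u = word_value G S v"
proof -
  have "filter (\<lambda>l. fst l < length S) w = w" if "w \<in> words {..<length S}" for w :: "nat gword"
    using that by (induction w) auto
  then show ?thesis
    using val_filter_equivclp[of u v] assms by (simp add: free_class_eq_iff)
qed

end

section \<open>Presented groups\<close>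

abbreviation presentation_marking :: "nat \<Rightarrow> nat gword set \<Rightarrow> nat gword set set list" where
  "presentation_marking k R \<equiv> map (presented_gen {..<k} R) [0..<k]"

lemma inv_free_group:
  assumes "u \<in> words X"
  shows "inv\<^bsub>free_group X\<^esub> (free_class X u) = free_class X (winv u)"
proof -
  interpret group "free_group X" by (rule group_free_group)
  show ?thesis
    using assms equivclp_cancels_winv[of u]
    by (intro inv_equality)
       (auto simp: mult_free_group one_free_group free_class_eq_iff free_class_in_carrier)
qed

lemma marking_presentation:
  assumes "R \<subseteq> words {..<k}"
  shows "marking (presented_group {..<k} R) (presentation_marking k R)"
  using presented_marked_group[OF assms]
  by (auto simp: marked_groups_def marking_def marking_axioms_def)

lemma presentation_value:
  assumes R: "R \<subseteq> words {..<k}" and w: "w \<in> words {..<k}"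
  shows "word_value (presented_group {..<k} R) (presentation_marking k R) w =
           relator_closure {..<k} R #>\<^bsub>free_group {..<k}\<^esub> free_class {..<k} w"
proof -
  let ?F = "free_group {..<k}" and ?N = "relator_closure {..<k} R"
  interpret N: normal ?N ?F using relator_closure_normal[OF R] .
  interpret M: group "?F Mod ?N" by (rule N.factorgroup_is_group)
  interpret h: group_hom ?F "?F Mod ?N" "\<lambda>x. ?N #>\<^bsub>?F\<^esub> x"
    by unfold_locales (rule N.r_coset_hom_Mod)
  show ?thesis using w
  proof (induction w)
    case Nil
    show ?case using h.hom_one by (simp add: presented_group_def one_free_group)
  next
    case (Cons l w)
    obtain x e where l: "l = (x, e)" by force
    have x: "x < k" and w: "w \<in> words {..<k}" using Cons.prems l by auto
    have g: "gen x \<in> words {..<k}" using x by simp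
    have "letter_value (presented_group {..<k} R) (presentation_marking k R) l =
            ?N #>\<^bsub>?F\<^esub> free_class {..<k} [l]"
      using x g h.hom_inv[OF free_class_in_carrier[OF g]]
      by (auto simp: letter_value_def l presented_gen_def presented_group_def inv_free_group
            gen_def winv_Cons)
    then show ?case
      using Cons w x l mult_free_group[of "[l]" "{..<k}" w]
        h.hom_mult[of "free_class {..<k} [l]" "free_class {..<k} w"]
      by (simp add: presented_group_def free_class_in_carrier)
  qed
qed

lemma presentation_value_eq_one_iff:
  assumes R: "R \<subseteq> words {..<k}" and w: "w \<in> words {..<k}"
  shows "word_value (presented_group {..<k} R) (presentation_marking k R) w =
           \<one>\<^bsub>presented_group {..<k} R\<^esub> \<longleftrightarrow>
         free_class {..<k} w \<in> relator_closure {..<k} R"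
proof -
  let ?F = "free_group {..<k}" and ?N = "relator_closure {..<k} R"
  interpret N: normal ?N ?F using relator_closure_normal[OF R] .
  have "\<one>\<^bsub>presented_group {..<k} R\<^esub> = ?N" by (simp add: presented_group_def)
  then show ?thesis
    using w N.coset_join1 N.coset_join2 N.is_subgroup N.subset
    by (metis presentation_value[OF R w] free_class_in_carrier)
qed

lemma presentation_relator:
  assumes "R \<subseteq> words {..<k}" "u \<in> R"
  shows "word_value (presented_group {..<k} R) (presentation_marking k R) u =
           \<one>\<^bsub>presented_group {..<k} R\<^esub>"
proof -
  have "free_class {..<k} u \<in> relator_closure {..<k} R"
    using assms(2) by (auto simp: relator_closure_def normal_closure_def)
  then show ?thesis using presentation_value_eq_one_iff assms by blast
qed

text \<open>Over a constant family this is the universal property.  In general it says that a single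
  consequence of \<open>R\<close> only uses finitely many relators.\<close>

lemma presentation_eventually:
  assumes R: "R \<subseteq> words {..<k}"
    and M: "\<And>n. marking (H n) (T n)" and len: "\<And>n. length (T n) = k"
    and rel: "\<And>u. u \<in> R \<Longrightarrow> \<forall>\<^sub>F n in F. word_value (H n) (T n) u = \<one>\<^bsub>H n\<^esub>"
    and w: "w \<in> words {..<k}"
    and one: "word_value (presented_group {..<k} R) (presentation_marking k R) w =
                \<one>\<^bsub>presented_group {..<k} R\<^esub>"
  shows "\<forall>\<^sub>F n in F. word_value (H n) (T n) w = \<one>\<^bsub>H n\<^esub>"
proof -
  let ?fc = "free_class {..<k}"
  \<comment> \<open>The free classes of eventually trivial words form a normal subgroup: products
    stay inside because two eventual statements hold eventually together. It contains the relators,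
    hence all of \<open>relator_closure\<close>.\<close>
  define E where "E = {u \<in> words {..<k}. \<forall>\<^sub>F n in F. word_value (H n) (T n) u = \<one>\<^bsub>H n\<^esub>}"
  interpret FG: group "free_group {..<k}" by (rule group_free_group)
  note val = marking.val_append[OF M, unfolded len] marking.val_winv[OF M, unfolded len]
  note closed = marking.val_closed[OF M, unfolded len]
  have grp: "group (H n)" for n using M by (simp add: marking_def)
  have app: "u @ v \<in> E" if "u \<in> E" "v \<in> E" for u v
    using that
    by (auto simp: E_def val group.is_monoid[OF grp] monoid.l_one elim: eventually_elim2)
  have winv: "winv u \<in> E" if "u \<in> E" for u
    using that by (auto simp: E_def val group.is_monoid[OF grp] monoid.inv_one[OF group.is_monoid[OF grp]] elim: eventually_mono)
  have conj: "u @ v @ winv u \<in> E" if "u \<in> words {..<k}" "v \<in> E" for u v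
    using that by (auto simp: E_def val closed group.r_inv[OF grp] group.is_monoid[OF grp] group.inv_closed[OF grp] monoid.l_one elim: eventually_mono)
  have EW: "E \<subseteq> words {..<k}" by (auto simp: E_def)
  have Nil: "[] \<in> E" by (simp add: E_def)
  have "?fc ` E \<lhd> free_group {..<k}"
    unfolding FG.normal_inv_iff
  proof (intro conjI ballI)
    show "subgroup (?fc ` E) (free_group {..<k})"
    proof (rule FG.subgroupI)
      show "?fc ` E \<subseteq> carrier (free_group {..<k})" using EW by (auto simp: carrier_free_group)
      show "?fc ` E \<noteq> {}" using Nil by auto
    next
      fix x assume "x \<in> ?fc ` E"
      then obtain u where "u \<in> E" "x = ?fc u" by auto
      then show "inv\<^bsub>free_group {..<k}\<^esub> x \<in> ?fc ` E"
        using winv EW by (auto simp: inv_free_group)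
    next
      fix x y assume "x \<in> ?fc ` E" "y \<in> ?fc ` E"
      then obtain u v where "u \<in> E" "x = ?fc u" "v \<in> E" "y = ?fc v" by auto
      then show "x \<otimes>\<^bsub>free_group {..<k}\<^esub> y \<in> ?fc ` E"
        using app[of u v] EW mult_free_group[of u "{..<k}" v] by blast
    qed
  next
    fix x y assume "x \<in> carrier (free_group {..<k})" "y \<in> ?fc ` E"
    then obtain u v where "u \<in> words {..<k}" "x = ?fc u" "v \<in> E" "y = ?fc v"
      by (auto simp: carrier_free_group)
    then show "x \<otimes>\<^bsub>free_group {..<k}\<^esub> y \<otimes>\<^bsub>free_group {..<k}\<^esub> inv\<^bsub>free_group {..<k}\<^esub> x \<in> ?fc ` E"
      using conj[of u v] EW by (auto simp: mult_free_group inv_free_group)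
  qed
  moreover have "?fc ` R \<subseteq> ?fc ` E" using R rel by (auto simp: E_def)
  ultimately have "relator_closure {..<k} R \<subseteq> ?fc ` E"
    by (auto simp: relator_closure_def normal_closure_def)
  moreover have "?fc w \<in> relator_closure {..<k} R"
    using one presentation_value_eq_one_iff[OF R w] by simp
  \<comment> \<open>\<open>w\<close> is so far only freely equal to some \<open>v\<close> in
    \<open>E\<close>; freely equal words have equal values in every marking.\<close>
  ultimately obtain v where v: "v \<in> E" "?fc w = ?fc v" by auto
  have "word_value (H n) (T n) w = word_value (H n) (T n) v" for n
    using marking.val_free_class[OF M, of w n v] v EW w by (auto simp: len)
  then show ?thesis using v(1) by (simp add: E_def)
qed

section \<open>Relations of marked presentations and convergence of marked groups\<close>

lemma marked_relations_presentation:
  assumes "R \<subseteq> words {..<k}"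
  shows "marked_relations k (marked_presentation k R) =
           {w \<in> words {..<k}. word_value (presented_group {..<k} R) (presentation_marking k R) w =
              \<one>\<^bsub>presented_group {..<k} R\<^esub>}"
  using marked_relations_eq[OF marked_presentation_in_space[OF assms]]
    equiv_class_self[OF equiv_marked_iso_rel presented_marked_group[OF assms]]
  by (simp add: marked_presentation_def marked_class_def)

text \<open>There are only finitely many words of length at most \<open>R\<close> over a finite
  alphabet, so agreement that is eventual for each single word is eventual for all of them at
  once.\<close>

lemma limitin_marked_topologyI:
  fixes C :: "'i \<Rightarrow> 'a marked_group set"
  assumes C: "\<And>n. C n \<in> marked_space k" and D: "D \<in> marked_space k"
    and ev: "\<And>w. w \<in> words {..<k} \<Longrightarrow>
               \<forall>\<^sub>F n in F. w \<in> marked_relations k (C n) \<longleftrightarrow> w \<in> marked_relations k D"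
  shows "limitin (marked_topology k) C D F"
proof -
  interpret Metric_space "marked_space k" "marked_dist k" by (rule Metric_space_marked_space)
  have "\<forall>\<^sub>F n in F. C n \<in> marked_space k \<and> marked_dist k (C n) D < \<epsilon>" if pos: "\<epsilon> > 0" for \<epsilon>
  proof -
    obtain R :: nat where R: "exp (- real R) < \<epsilon>"
    proof -
      have "(\<lambda>R. exp (- real R)) \<longlonglongrightarrow> 0" by real_asymp
      then have "\<forall>\<^sub>F R in sequentially. exp (- real R) < \<epsilon>" using pos by (rule order_tendstoD(2))
      then show ?thesis using that unfolding eventually_sequentially by blast
    qed
    have "{w \<in> words {..<k}. length w \<le> R} = {w. set w \<subseteq> {..<k} \<times> UNIV \<and> length w \<le> R}"
      unfolding words_def by auto
    then have "finite {w \<in> words {..<k}. length w \<le> R}"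
      by (simp only:) (rule finite_lists_length_le, simp)
    then have "\<forall>\<^sub>F n in F. \<forall>w\<in>{w \<in> words {..<k}. length w \<le> R}.
                 w \<in> marked_relations k (C n) \<longleftrightarrow> w \<in> marked_relations k D"
      using ev by (intro eventually_ball_finite) auto
    \<comment> \<open>\<open>same_relations\<close> ranges over all words; those outside
      \<open>words {..<k}\<close> are relations of neither class.\<close>
    moreover have "marked_relations k E \<subseteq> words {..<k}" if "E \<in> marked_space k" for E :: "'a marked_group set"
    proof -
      obtain M where "M \<in> marked_groups k" "E = marked_iso_rel k `` {M}"
        using \<open>E \<in> marked_space k\<close> unfolding marked_space_def by (rule quotientE)
      then have "M \<in> E" using equiv_class_self[OF equiv_marked_iso_rel] by blast
      moreover obtain G S where "M = (G, S)" by (rule prod.exhaust)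
      ultimately have "(G, S) \<in> E" by simp
      then show ?thesis using marked_relations_eq[OF that] by auto
    qed
    ultimately show ?thesis
    proof (elim eventually_mono)
      fix n
      assume sub: "\<And>E :: 'a marked_group set. E \<in> marked_space k \<Longrightarrow> marked_relations k E \<subseteq> words {..<k}"
        and "\<forall>w\<in>{w \<in> words {..<k}. length w \<le> R}.
               w \<in> marked_relations k (C n) \<longleftrightarrow> w \<in> marked_relations k D"
      then have "same_relations k R (C n) D"
        unfolding same_relations_def using sub[OF C] sub[OF D] by blast
      then have "marked_dist k (C n) D < \<epsilon>" using R marked_dist_le_iff[of k "C n" D R] by simp
      then show "C n \<in> marked_space k \<and> marked_dist k (C n) D < \<epsilon>" using C by simp
    qed
  qed
  then show ?thesis using D by (simp add: marked_topology_def limitin_metric)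
qed

section \<open>Normal forms in groups satisfying Thompson's relations\<close>

text \<open>The rewriting to \<open>u v\<^sup>-\<^sup>1\<close> is given by explicit functions on words, since its results in two
  different groups have to be compared.  It moves \<open>X k\<^sup>-\<^sup>1\<close> to the right across a positive word.\<close>

fun push_neg :: "nat \<Rightarrow> nat list \<Rightarrow> nat list \<times> nat list" where
  "push_neg k [] = ([], [k])"
| "push_neg k (n # u) =
     (if n = k then (u, [])
      else if k < n then (let (u', q) = push_neg k u in (Suc n # u', q))
      else (let (u', q) = push_neg (Suc k) u in (n # u', q)))"

fun pos_neg_form :: "nat gword \<Rightarrow> nat list \<times> nat list" where
  "pos_neg_form [] = ([], [])"
| "pos_neg_form ((n, e) # w) =
     (let (u, v) = pos_neg_form w
      in if e then (n # u, v) else (let (u', q) = push_neg n u in (u', v @ q)))"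

context group
begin

lemma inv_mult_cancel [simp]:
  "x \<in> carrier G \<Longrightarrow> y \<in> carrier G \<Longrightarrow> inv x \<otimes> (x \<otimes> y) = y"
  "x \<in> carrier G \<Longrightarrow> y \<in> carrier G \<Longrightarrow> x \<otimes> (inv x \<otimes> y) = y"
  by (simp_all flip: m_assoc)

lemma left_cancel:
  "x \<in> carrier G \<Longrightarrow> y \<in> carrier G \<Longrightarrow> z \<in> carrier G \<Longrightarrow> x \<otimes> y = x \<otimes> z \<longleftrightarrow> y = z"
  by (metis inv_mult_cancel(1))

lemma commute_inv:
  assumes "x \<in> carrier G" "y \<in> carrier G" "x \<otimes> y = y \<otimes> x"
  shows "x \<otimes> inv y = inv y \<otimes> x"
proof -
  have "x \<otimes> inv y = inv y \<otimes> (y \<otimes> x) \<otimes> inv y" using assms(1,2) by simp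
  also have "\<dots> = inv y \<otimes> (x \<otimes> y) \<otimes> inv y" using assms(3) by simp
  also have "\<dots> = inv y \<otimes> x" using assms(1,2) by (simp add: m_assoc)
  finally show ?thesis .
qed

lemma commute_mult:
  assumes "x \<in> carrier G" "y \<in> carrier G" "z \<in> carrier G"
    and "x \<otimes> y = y \<otimes> x" "x \<otimes> z = z \<otimes> x"
  shows "x \<otimes> (y \<otimes> z) = (y \<otimes> z) \<otimes> x"
  using assms by (metis m_assoc)

end

text \<open>\<open>R1\<close> and \<open>R2\<close> say that \<open>b a^-1\<close> commutes with
  \<open>X 2\<close> and with \<open>X 3\<close>, for the elements \<open>X n\<close> introduced
  below.\<close>

locale thompson_pair = group G for G (structure) +
  fixes a b
  assumes a_closed [simp]: "a \<in> carrier G" and b_closed [simp]: "b \<in> carrier G"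
    and rel1: "(b \<otimes> inv a) \<otimes> (inv a \<otimes> b \<otimes> a) = (inv a \<otimes> b \<otimes> a) \<otimes> (b \<otimes> inv a)"
    and rel2: "(b \<otimes> inv a) \<otimes> (inv a \<otimes> (inv a \<otimes> b \<otimes> a) \<otimes> a) =
               (inv a \<otimes> (inv a \<otimes> b \<otimes> a) \<otimes> a) \<otimes> (b \<otimes> inv a)"
begin

fun X :: "nat \<Rightarrow> 'a" where
  "X 0 = a"
| "X (Suc 0) = b"
| "X (Suc (Suc n)) = inv a \<otimes> X (Suc n) \<otimes> a"

lemma X_closed [simp]: "X n \<in> carrier G"
  by (induction n rule: X.induct) auto

lemma X_Suc: "1 \<le> n \<Longrightarrow> X (Suc n) = inv a \<otimes> X n \<otimes> a"
  by (cases n) auto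

text \<open>Conjugation by \<open>a\<close> raises every index of the relation by one, as long as
  none of them is 0.\<close>

lemma X_shift_Suc:
  assumes "1 \<le> k" "1 \<le> n" "X n \<otimes> X k = X k \<otimes> X (Suc n)"
  shows "X (Suc n) \<otimes> X (Suc k) = X (Suc k) \<otimes> X (Suc (Suc n))"
proof -
  have "X (Suc n) \<otimes> X (Suc k) = inv a \<otimes> (X n \<otimes> X k) \<otimes> a"
    using assms(1,2) by (simp add: X_Suc m_assoc)
  also have "\<dots> = X (Suc k) \<otimes> X (Suc (Suc n))"
    unfolding assms(3) using assms(1,2) by (simp add: X_Suc[of k] X_Suc[of "Suc n"] m_assoc)
  finally show ?thesis .
qed

text \<open>Multiplying the shift relation on the right by \<open>a^-1\<close> turns
  \<open>b X (Suc n)\<close> into \<open>b a^-1 X n\<close>.\<close>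

lemma X_shift_one_iff:
  assumes "1 \<le> n"
  shows "X n \<otimes> b = b \<otimes> X (Suc n) \<longleftrightarrow> (b \<otimes> inv a) \<otimes> X n = X n \<otimes> (b \<otimes> inv a)"
proof -
  have "X n \<otimes> b = (X n \<otimes> (b \<otimes> inv a)) \<otimes> a" by (simp add: m_assoc)
  moreover have "b \<otimes> X (Suc n) = ((b \<otimes> inv a) \<otimes> X n) \<otimes> a"
    using assms by (simp add: X_Suc m_assoc)
  ultimately show ?thesis by (metis X_closed a_closed b_closed inv_closed m_closed right_cancel)
qed

text \<open>The case \<open>m = 1\<close> is \<open>rel1\<close>; conjugation by \<open>a\<close>
  gives the others.\<close>

lemma X_shift_adjacent: "1 \<le> m \<Longrightarrow> X (Suc m) \<otimes> X m = X m \<otimes> X (Suc (Suc m))"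
proof (induction m rule: dec_induct)
  case base
  show ?case using X_shift_one_iff[of 2] rel1 by (simp add: numeral_2_eq_2)
next
  case (step m)
  then show ?case using X_shift_Suc[of m "Suc m"] by simp
qed

text \<open>Why two relators suffice: for \<open>n \<ge> 4\<close> the adjacent relation gives
  \<open>X n = X (n-2)^-1 X (n-1) X (n-2)\<close>, so commuting with \<open>b a^-1\<close> is
  inherited from the two preceding indices, starting at \<open>rel1\<close> and
  \<open>rel2\<close>.\<close>

lemma X_shift_one: "2 \<le> n \<Longrightarrow> X n \<otimes> b = b \<otimes> X (Suc n)"
proof -
  let ?d = "b \<otimes> inv a"
  have "?d \<otimes> X n = X n \<otimes> ?d" if "2 \<le> n" for n
    using that
  proof (induction n rule: less_induct)
    case (less n)
    consider "n = 2" | "n = 3" | "4 \<le> n" using less.prems by linarith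
    then show ?case
    proof cases
      case 3
      define m where "m = n - 2"
      have n: "n = Suc (Suc m)" and m: "2 \<le> m" using 3 by (auto simp: m_def)
      have "X n = inv (X m) \<otimes> (X m \<otimes> X n)" by simp
      also have "X m \<otimes> X n = X (Suc m) \<otimes> X m" using X_shift_adjacent[of m] m n by simp
      finally have "X n = inv (X m) \<otimes> (X (Suc m) \<otimes> X m)" .
      then show ?thesis using less.IH[of m] less.IH[of "Suc m"] m n
        by (simp add: commute_mult commute_inv del: inv_mult_cancel)
    qed (use rel1 rel2 in \<open>simp_all add: numeral_2_eq_2 numeral_3_eq_3\<close>)
  qed
  then show "2 \<le> n \<Longrightarrow> X n \<otimes> b = b \<otimes> X (Suc n)" using X_shift_one_iff[of n] by simp
qed

text \<open>For \<open>k = 0\<close> this is the definition of \<open>X\<close>, for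
  \<open>k = 1\<close> the previous lemma; conjugation by \<open>a\<close> gives the rest.\<close>

lemma X_shift: "k < n \<Longrightarrow> X n \<otimes> X k = X k \<otimes> X (Suc n)"
proof (induction k arbitrary: n)
  case 0
  then show ?case by (simp add: X_Suc m_assoc)
next
  case (Suc k)
  then obtain m where m: "n = Suc m" "k < m" by (cases n) auto
  show ?case
  proof (cases "k = 0")
    case True
    then show ?thesis using X_shift_one[of n] m by simp
  next
    case False
    then show ?thesis using X_shift_Suc[of k m] Suc.IH[of m] m by simp
  qed
qed

section \<open>Positive words in the \<open>X n\<close> and their quotients\<close>

definition pos_val :: "nat list \<Rightarrow> 'a" where
  "pos_val u = foldr (\<lambda>n y. X n \<otimes> y) u \<one>"

lemma pos_val_Nil [simp]: "pos_val [] = \<one>"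
  and pos_val_Cons [simp]: "pos_val (n # u) = X n \<otimes> pos_val u"
  by (simp_all add: pos_val_def)

lemma pos_val_closed [simp]: "pos_val u \<in> carrier G"
  by (induction u) auto

lemma pos_val_append: "pos_val (u @ v) = pos_val u \<otimes> pos_val v"
  by (induction u) (auto simp: m_assoc)

lemma pos_val_shift:
  "\<forall>i\<in>set u. k < i \<Longrightarrow> pos_val u \<otimes> X k = X k \<otimes> pos_val (map Suc u)"
proof (induction u)
  case (Cons n u)
  then have "pos_val (n # u) \<otimes> X k = (X n \<otimes> X k) \<otimes> pos_val (map Suc u)"
    by (simp add: m_assoc)
  also have "\<dots> = X k \<otimes> pos_val (map Suc (n # u))" using Cons.prems by (simp add: X_shift m_assoc)
  finally show ?case .
qed simp

text \<open>Meant for the first occurrence of the least index of a word: cancelling it leaves a word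
  with one letter less, which drives the later induction.\<close>

lemma pos_val_extract:
  assumes "\<forall>i\<in>set u. k < i"
  shows "pos_val (u @ k # v) = X k \<otimes> pos_val (map Suc u @ v)"
  using pos_val_shift[OF assms] by (simp add: pos_val_append flip: m_assoc)

text \<open>The three cases are \<open>X k^-1 X k = 1\<close>,
  \<open>X k^-1 X n = X (Suc n) X k^-1\<close> for \<open>k < n\<close>, and
  \<open>X k^-1 X n = X n X (Suc k)^-1\<close> for \<open>n < k\<close>; the last two rearrange
  \<open>X_shift\<close>.\<close>

lemma push_neg_val:
  "push_neg k u = (u', q) \<Longrightarrow> inv (X k) \<otimes> pos_val u = pos_val u' \<otimes> inv (pos_val q)"
proof (induction k u arbitrary: u' q rule: push_neg.induct)
  case (1 k)
  then show ?case by auto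
next
  case (2 k n u)
  consider "n = k" | "k < n" | "n < k" by linarith
  then show ?case
  proof cases
    case 1
    then show ?thesis using "2.prems" by auto
  next
    case 2
    obtain v where v: "push_neg k u = (v, q)" "u' = Suc n # v"
      using "2.prems" 2 by (auto split: prod.splits)
    have "inv (X k) \<otimes> X n = inv (X k) \<otimes> (X n \<otimes> X k) \<otimes> inv (X k)" by (simp add: m_assoc)
    also have "\<dots> = X (Suc n) \<otimes> inv (X k)" using 2 by (simp add: X_shift)
    finally have "inv (X k) \<otimes> pos_val (n # u) = X (Suc n) \<otimes> (inv (X k) \<otimes> pos_val u)"
      by (simp flip: m_assoc)
    then show ?thesis using "2.IH"(1)[OF _ _ v(1)] 2 v(2) by (simp add: m_assoc)
  next
    case 3
    obtain v where v: "push_neg (Suc k) u = (v, q)" "u' = n # v"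
      using "2.prems" 3 by (auto split: prod.splits)
    have "inv (X k) \<otimes> X n = inv (X k) \<otimes> (X n \<otimes> X (Suc k)) \<otimes> inv (X (Suc k))"
      by (simp add: m_assoc del: X.simps)
    also have "\<dots> = X n \<otimes> inv (X (Suc k))"
      using X_shift[OF 3] by (simp add: m_assoc del: X.simps flip: X_shift[OF 3])
    finally have "inv (X k) \<otimes> pos_val (n # u) = X n \<otimes> (inv (X (Suc k)) \<otimes> pos_val u)"
      by (simp del: X.simps flip: m_assoc)
    then show ?thesis using "2.IH"(2)[OF _ _ v(1)] 3 v(2) by (simp add: m_assoc del: X.simps)
  qed
qed

lemma pos_neg_form_val:
  assumes "w \<in> words {..<2}" "pos_neg_form w = (u, v)"
  shows "word_value G [a, b] w = pos_val u \<otimes> inv (pos_val v)"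
  using assms
proof (induction w arbitrary: u v)
  case (Cons l w)
  obtain n e where l: "l = (n, e)" by force
  obtain u' v' where uv: "pos_neg_form w = (u', v')" by force
  have IH: "word_value G [a, b] w = pos_val u' \<otimes> inv (pos_val v')" and n: "n = 0 \<or> n = 1"
    using Cons uv l by auto
  have n: "[a, b] ! n = X n" using n by auto
  show ?case
  proof (cases e)
    case True
    then show ?thesis using Cons.prems uv l n IH by (auto simp: letter_value_def m_assoc)
  next
    case False
    obtain q where q: "push_neg n u' = (u, q)" "v = v' @ q"
      using Cons.prems uv l False by (auto split: prod.splits)
    have "word_value G [a, b] (l # w) = (inv (X n) \<otimes> pos_val u') \<otimes> inv (pos_val v')"
      using l n IH False by (simp add: letter_value_def m_assoc)
    then show ?thesis
      using push_neg_val[OF q(1)] q(2) by (simp add: pos_val_append inv_mult_group m_assoc)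
  qed
qed auto

end

section \<open>Order automorphisms of the line\<close>

text \<open>Increasing bijections of the whole line form a group for simple reasons, and
  monotonicity is what the later dynamics use.\<close>

definition order_auts :: "(real \<Rightarrow> real) monoid" where
  "order_auts = \<lparr>carrier = {f. strict_mono f \<and> surj f}, mult = (\<circ>), one = id\<rparr>"

lemma order_auts_simps [simp]:
  "f \<in> carrier order_auts \<longleftrightarrow> strict_mono f \<and> surj f"
  "f \<otimes>\<^bsub>order_auts\<^esub> g = f \<circ> g"
  "\<one>\<^bsub>order_auts\<^esub> = id"
  by (simp_all add: order_auts_def)

lemma strict_mono_inv_surj:
  fixes f :: "real \<Rightarrow> real"
  assumes "strict_mono f" "surj f"
  shows "strict_mono (inv_into UNIV f)"
proof (rule strict_monoI)
  fix x y :: real assume "x < y"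
  then have "f (inv_into UNIV f x) < f (inv_into UNIV f y)"
    using assms(2) by (simp add: surj_f_inv_f)
  then show "inv_into UNIV f x < inv_into UNIV f y"
    using assms(1) strict_mono_less by blast
qed

lemma group_order_auts: "group order_auts"
proof (rule groupI)
  fix f assume "f \<in> carrier order_auts"
  then have f: "strict_mono f" "surj f" "inj f" by (auto simp: strict_mono_imp_inj_on)
  then show "\<exists>g\<in>carrier order_auts. g \<otimes>\<^bsub>order_auts\<^esub> f = \<one>\<^bsub>order_auts\<^esub>"
    by (intro bexI[of _ "inv_into UNIV f"]) (auto simp: strict_mono_inv_surj inj_imp_surj_inv)
next
  fix f g assume "f \<in> carrier order_auts" "g \<in> carrier order_auts"
  then show "f \<otimes>\<^bsub>order_auts\<^esub> g \<in> carrier order_auts"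
    unfolding order_auts_simps by (metis strict_mono_o comp_surj)
qed (simp_all add: o_assoc strict_mono_def)

interpretation order_auts: group order_auts
  by (rule group_order_auts)

lemma inv_order_auts [simp]:
  assumes "strict_mono f" "surj f"
  shows "inv\<^bsub>order_auts\<^esub> f = inv_into UNIV f"
proof (rule order_auts.inv_equality)
  have "inj f" using assms(1) by (rule strict_mono_imp_inj_on)
  then show "inv_into UNIV f \<otimes>\<^bsub>order_auts\<^esub> f = \<one>\<^bsub>order_auts\<^esub>" "inv_into UNIV f \<in> carrier order_auts"
    using assms by (simp_all add: strict_mono_inv_surj inj_imp_surj_inv)
qed (use assms in simp)

text \<open>By injectivity a point moved by \<open>f\<close> is sent to another point moved by
  \<open>f\<close>, and \<open>h\<close> fixes both; so both composites equal \<open>f\<close>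
  there.\<close>

lemma disjoint_moves_commute:
  assumes "inj f" "inj h" "\<And>t. f t = t \<or> h t = t"
  shows "f \<circ> h = h \<circ> f"
proof
  fix t
  show "(f \<circ> h) t = (h \<circ> f) t"
  proof (cases "f t = t")
    case True
    then show ?thesis using assms(3)[of "h t"] injD[OF assms(2), of "h t" t] by auto
  next
    case False
    then have "h t = t" "f (f t) \<noteq> f t"
      using assms(3)[of t] injD[OF assms(1), of "f t" t] by auto
    then show ?thesis using assms(3)[of "f t"] by simp
  qed
qed

section \<open>The homeomorphisms \<open>x0\<close>, \<open>x1\<close> and their inverses\<close>

definition x0_inv :: "real \<Rightarrow> real" where
  "x0_inv t = (if t \<in> {0..1/4} then 2 * t
               else if t \<in> {1/4..1/2} then t + 1/4
               else if t \<in> {1/2..1} then (t + 1) / 2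
               else t)"

definition x1_inv :: "real \<Rightarrow> real" where
  "x1_inv t = (if t \<in> {1/2..1} then 1/2 + 1/2 * x0_inv (2 * t - 1) else t)"

lemma x0_x0_inv [simp]: "x0 (x0_inv t) = t" and x0_inv_x0 [simp]: "x0_inv (x0 t) = t"
  by (auto simp: x0_def x0_inv_def field_simps)

lemma x1_eq:
  "x1 t = (if t \<in> {1/2..3/4} then t / 2 + 1/4
           else if t \<in> {3/4..7/8} then t - 1/8
           else if t \<in> {7/8..1} then 2 * t - 1
           else t)"
  by (auto simp: x1_def x0_def field_simps)

lemma x1_fixes: "t \<le> 1/2 \<Longrightarrow> x1 t = t"
  by (auto simp: x1_eq)

lemma x1_inv_eq:
  "x1_inv t = (if t \<in> {1/2..5/8} then 2 * t - 1/2
               else if t \<in> {5/8..3/4} then t + 1/8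
               else if t \<in> {3/4..1} then (t + 1) / 2
               else t)"
  by (auto simp: x1_inv_def x0_inv_def field_simps)

lemma x1_x1_inv [simp]: "x1 (x1_inv t) = t" and x1_inv_x1 [simp]: "x1_inv (x1 t) = t"
  by (auto simp: x1_eq x1_inv_eq field_simps)

lemma strict_mono_x0: "strict_mono x0" and strict_mono_x1: "strict_mono x1"
  and strict_mono_x0_inv: "strict_mono x0_inv"
  by (auto simp: strict_mono_def x0_def x1_eq x0_inv_def)

lemma surj_x0: "surj x0" and surj_x1: "surj x1"
  by (metis x0_x0_inv surjI, metis x1_x1_inv surjI)

lemma inv_x0: "inv_into UNIV x0 = x0_inv" and inv_x1: "inv_into UNIV x1 = x1_inv"
  by (rule Hilbert_Choice.inv_equality; simp)+

text \<open>The element \<open>x1 x0^-1\<close> is the identity from 3/4 on, while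
  \<open>X 2\<close> and \<open>X 3\<close> are the identity up to 3/4, so the relators hold because
  no point is moved by both factors.\<close>

interpretation thompson: thompson_pair order_auts x0 x1
proof
  have carr: "x0 \<in> carrier order_auts" "x1 \<in> carrier order_auts"
    by (simp_all add: strict_mono_x0 strict_mono_x1 surj_x0 surj_x1)
  then show "x0 \<in> carrier order_auts" "x1 \<in> carrier order_auts" .
  have inv: "inv\<^bsub>order_auts\<^esub> x0 = x0_inv"
    using carr by (simp add: inv_x0)
  have inv_carr: "x0_inv \<in> carrier order_auts" using order_auts.inv_closed[OF carr(1)] inv by simp
  have inj: "inj f" if "f \<in> carrier order_auts" for f
    using that by (simp add: strict_mono_imp_inj_on)
  have d: "x1 (x0_inv t) = t" if "3/4 \<le> t" for t
    using that by (auto simp: x1_eq x0_inv_def field_simps)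
  have low: "x0 t \<le> 1/2" if "t \<le> 3/4" for t
    using that by (auto simp: x0_def)
  have X2: "x0_inv (x1 (x0 t)) = t" if "t \<le> 3/4" for t
    using low[OF that] by (simp add: x1_fixes)
  have X3: "x0_inv (x0_inv (x1 (x0 (x0 t)))) = t" if "t \<le> 3/4" for t
    using X2[of "x0 t"] low[OF that] by simp
  let ?d = "x1 \<otimes>\<^bsub>order_auts\<^esub> x0_inv"
  let ?X2 = "x0_inv \<otimes>\<^bsub>order_auts\<^esub> x1 \<otimes>\<^bsub>order_auts\<^esub> x0"
  let ?X3 = "x0_inv \<otimes>\<^bsub>order_auts\<^esub> ?X2 \<otimes>\<^bsub>order_auts\<^esub> x0"
  have mem: "?d \<in> carrier order_auts" "?X2 \<in> carrier order_auts" "?X3 \<in> carrier order_auts"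
    by (intro order_auts.m_closed carr inv_carr)+
  have "?d t = t \<or> ?X2 t = t" "?d t = t \<or> ?X3 t = t" for t
    using d[of t] X2[of t] X3[of t] by (cases "t \<le> 3/4"; simp)+
  then show
    "x1 \<otimes>\<^bsub>order_auts\<^esub> inv\<^bsub>order_auts\<^esub> x0 \<otimes>\<^bsub>order_auts\<^esub>
       (inv\<^bsub>order_auts\<^esub> x0 \<otimes>\<^bsub>order_auts\<^esub> x1 \<otimes>\<^bsub>order_auts\<^esub> x0) =
     inv\<^bsub>order_auts\<^esub> x0 \<otimes>\<^bsub>order_auts\<^esub> x1 \<otimes>\<^bsub>order_auts\<^esub> x0 \<otimes>\<^bsub>order_auts\<^esub>
       (x1 \<otimes>\<^bsub>order_auts\<^esub> inv\<^bsub>order_auts\<^esub> x0)"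
    "x1 \<otimes>\<^bsub>order_auts\<^esub> inv\<^bsub>order_auts\<^esub> x0 \<otimes>\<^bsub>order_auts\<^esub>
       (inv\<^bsub>order_auts\<^esub> x0 \<otimes>\<^bsub>order_auts\<^esub>
         (inv\<^bsub>order_auts\<^esub> x0 \<otimes>\<^bsub>order_auts\<^esub> x1 \<otimes>\<^bsub>order_auts\<^esub> x0) \<otimes>\<^bsub>order_auts\<^esub> x0) =
     inv\<^bsub>order_auts\<^esub> x0 \<otimes>\<^bsub>order_auts\<^esub>
         (inv\<^bsub>order_auts\<^esub> x0 \<otimes>\<^bsub>order_auts\<^esub> x1 \<otimes>\<^bsub>order_auts\<^esub> x0) \<otimes>\<^bsub>order_auts\<^esub> x0 \<otimes>\<^bsub>order_auts\<^esub>
       (x1 \<otimes>\<^bsub>order_auts\<^esub> inv\<^bsub>order_auts\<^esub> x0)"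
    unfolding inv order_auts_simps(2)[of ?d] order_auts_simps(2)[of _ ?d]
    by (intro disjoint_moves_commute inj mem; blast)+
qed

section \<open>How the homeomorphisms \<open>X n\<close> move points\<close>

lemma X_Suc_apply: "1 \<le> n \<Longrightarrow> thompson.X (Suc n) t = x0_inv (thompson.X n (x0 t))"
  using thompson.X_Suc[of n] by (simp add: strict_mono_x0 surj_x0 inv_x0)

lemma x0_le: "x0 t \<le> t" and x1_le: "x1 t \<le> t"
  by (auto simp: x0_def x1_eq)

lemma X_le: "thompson.X n t \<le> t"
proof (induction n arbitrary: t rule: thompson.X.induct)
  case (3 n)
  have "x0_inv (thompson.X (Suc n) (x0 t)) \<le> x0_inv (x0 t)"
    using 3 strict_mono_less_eq[OF strict_mono_x0_inv] by blast
  then show ?case by (simp only: X_Suc_apply[of "Suc n"] x0_inv_x0)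
qed (simp_all add: x0_le x1_le)

text \<open>For \<open>n \<ge> 1\<close> the points \<open>1 - 1/2^n\<close> are consecutive in one
  orbit of \<open>x0\<close>; conjugation by \<open>x0\<close> therefore carries what
  \<open>X n\<close> does at one of them to what \<open>X (Suc n)\<close> does at the next.\<close>

lemma x0_dyadic: "1 \<le> n \<Longrightarrow> x0 (1 - 1 / 2 ^ Suc n) = 1 - 1 / 2 ^ n"
proof -
  assume "1 \<le> n"
  then have "(1::real) / 2 ^ n \<le> 1 / 2 ^ 1"
    by (intro divide_left_mono power_increasing) auto
  moreover have "(0::real) < 1 / 2 ^ n" by simp
  moreover have "(1::real) / 2 ^ Suc n = (1 / 2 ^ n) / 2" by simp
  ultimately show ?thesis by (auto simp: x0_def simp del: power_Suc)
qed

lemma X_fixes: "t \<le> 1 - 1 / 2 ^ n \<Longrightarrow> thompson.X n t = t"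
proof (induction n arbitrary: t rule: thompson.X.induct)
  case (3 n)
  have "x0 t \<le> 1 - 1 / 2 ^ Suc n"
    using "3.prems" x0_dyadic[of "Suc n"] strict_mono_less_eq[OF strict_mono_x0] by (metis le_add1 plus_1_eq_Suc)
  then have "thompson.X (Suc n) (x0 t) = x0 t" by (rule "3.IH")
  then show ?case by (simp only: X_Suc_apply[of "Suc n"] x0_inv_x0)
qed (auto simp: x0_def x1_eq)

text \<open>Together with \<open>X_fixes\<close>: this point is moved by \<open>X n\<close> and
  fixed by every \<open>X m\<close> with \<open>m > n\<close>, so it detects the letter
  \<open>n\<close>.\<close>

lemma X_moves: "thompson.X n (1 - 1 / 2 ^ Suc n) < 1 - 1 / 2 ^ Suc n"
proof (induction n rule: thompson.X.induct)
  case (3 n)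
  let ?p = "\<lambda>n. 1 - 1 / 2 ^ Suc n :: real"
  have "x0_inv (thompson.X (Suc n) (?p (Suc n))) < x0_inv (?p (Suc n))"
    using 3 strict_mono_less[OF strict_mono_x0_inv] by blast
  moreover have "x0 (?p (Suc (Suc n))) = ?p (Suc n)" by (rule x0_dyadic) simp
  ultimately show ?case by (metis X_Suc_apply x0_inv_x0 le_add1 plus_1_eq_Suc)
next
  case 1
  show ?case unfolding thompson.X.simps by (simp add: x0_def)
next
  case 2
  show ?case unfolding thompson.X.simps by (simp add: x1_eq)
qed

text \<open>Every letter moves points weakly downwards, so letters further left cannot undo a
  descent.\<close>

lemma pos_val_le: "thompson.pos_val u t \<le> t"
proof (induction u)
  case (Cons n u)
  have "thompson.X n (thompson.pos_val u t) \<le> thompson.pos_val u t" by (rule X_le)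
  with Cons show ?case by simp
qed simp

text \<open>Hence the least index occurring in a positive word is determined by the value of the word.\<close>

lemma pos_val_moves_iff:
  assumes "\<forall>i\<in>set u. k \<le> i"
  shows "thompson.pos_val u (1 - 1 / 2 ^ Suc k) \<noteq> 1 - 1 / 2 ^ Suc k \<longleftrightarrow> k \<in> set u"
  using assms
proof (induction u)
  case (Cons n u)
  let ?p = "1 - 1 / 2 ^ Suc k :: real"
  have le: "thompson.X n (thompson.pos_val u ?p) \<le> thompson.pos_val u ?p" by (rule X_le)
  show ?case
  proof (cases "k \<in> set u")
    case True
    then have "thompson.pos_val u ?p < ?p" using Cons pos_val_le[of u ?p] by auto
    with le True show ?thesis by simp
  next
    case False
    then have eq: "thompson.pos_val u ?p = ?p" using Cons by auto
    show ?thesis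
    proof (cases "n = k")
      case True
      then show ?thesis using X_moves[of k] eq by simp
    next
      case False
      then have "Suc k \<le> n" using Cons.prems by simp
      then have "(1::real) / 2 ^ n \<le> 1 / 2 ^ Suc k"
        by (intro divide_left_mono power_increasing) auto
      then have "thompson.X n ?p = ?p" by (intro X_fixes) simp
      then show ?thesis using eq False \<open>k \<notin> set u\<close> by simp
    qed
  qed
qed simp

section \<open>Thompson's relations present the group generated by \<open>x0\<close> and \<open>x1\<close>\<close>

context thompson_pair
begin

lemma pos_val_eq: "thompson.pos_val u = thompson.pos_val v \<Longrightarrow> pos_val u = pos_val v"
proof (induction "length u + length v" arbitrary: u v rule: less_induct)
  case less
  show ?case
  proof (cases "u @ v = []")
    case False
    define k where "k = Min (set (u @ v))"
    have min: "\<forall>i\<in>set u. k \<le> i" "\<forall>i\<in>set v. k \<le> i" by (auto simp: k_def)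
    have "k \<in> set (u @ v)" unfolding k_def using False by (intro Min_in) auto
    \<comment> \<open>The common homeomorphism decides whether \<open>k\<close> occurs, so
      \<open>k\<close> occurs in both words although it was chosen as the minimum of their
      union.\<close>
    moreover have "k \<in> set u \<longleftrightarrow> k \<in> set v"
      using pos_val_moves_iff[OF min(1)] pos_val_moves_iff[OF min(2)] less.prems by simp
    ultimately have "k \<in> set u" "k \<in> set v" by auto
    then obtain u1 u2 v1 v2 where u: "u = u1 @ k # u2" "k \<notin> set u1" and v: "v = v1 @ k # v2" "k \<notin> set v1"
      by (meson split_list_first)
    have gt: "\<forall>i\<in>set u1. k < i" "\<forall>i\<in>set v1. k < i"
      using min u v by (auto simp: order.strict_iff_order)
    \<comment> \<open>Cancelling \<open>X k\<close> on the left among the homeomorphisms leaves a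
      pair of words whose total length is smaller by two.\<close>
    let ?u = "map Suc u1 @ u2" and ?v = "map Suc v1 @ v2"
    have "thompson.pos_val ?u = thompson.pos_val ?v"
      using less.prems order_auts.left_cancel[OF thompson.X_closed thompson.pos_val_closed thompson.pos_val_closed]
      unfolding u v thompson.pos_val_extract[OF gt(1)] thompson.pos_val_extract[OF gt(2)] by blast
    then have "pos_val ?u = pos_val ?v" by (rule less.hyps[rotated]) (simp add: u v)
    then show ?thesis unfolding u v pos_val_extract[OF gt(1)] pos_val_extract[OF gt(2)] by simp
  qed simp
qed

text \<open>\<open>pos_neg_form\<close> depends on the word alone, so the same two positive words
  express \<open>w\<close> among the homeomorphisms and in the abstract group.\<close>

theorem thompson_relation_trivial:
  assumes w: "w \<in> words {..<2}" and one: "word_value order_auts [x0, x1] w = id"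
  shows "word_value G [a, b] w = \<one>"
proof -
  obtain u v where uv: "pos_neg_form w = (u, v)" by force
  have "thompson.pos_val u \<otimes>\<^bsub>order_auts\<^esub> inv\<^bsub>order_auts\<^esub> thompson.pos_val v = \<one>\<^bsub>order_auts\<^esub>"
    using one thompson.pos_neg_form_val[OF w uv] by simp
  then have "thompson.pos_val u = thompson.pos_val v"
    by (metis order_auts.inv_closed order_auts.inv_equality order_auts.inv_inv thompson.pos_val_closed)
  then have "pos_val u = pos_val v" by (rule pos_val_eq)
  then show ?thesis using pos_neg_form_val[OF w uv] by simp
qed

end

context marking
begin

lemma thompson_pair_iff:
  assumes "2 \<le> length S"
  shows "thompson_pair G (S ! 0) (S ! 1) \<longleftrightarrow> word_value G S R1 = \<one> \<and> word_value G S R2 = \<one>"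
proof -
  let ?a = "S ! 0" and ?b = "S ! 1"
  have c: "?a \<in> carrier G" "?b \<in> carrier G"
    using assms nth_closed[of 0] nth_closed[of 1] by linarith+
  have pow: "?a [^] (2::int) = ?a \<otimes> ?a" "?a [^] (-2::int) = inv ?a \<otimes> inv ?a"
    using c by (simp_all add: int_pow_def2 numeral_2_eq_2 inv_mult_group)
  have "gen 0 \<in> words {..<length S}" "gen 1 \<in> words {..<length S}" "0 < length S" "1 < length S"
    using assms by (simp_all flip: length_greater_0_conv)
  then show ?thesis
    using c by (simp add: thompson_pair_def thompson_pair_axioms_def R1_def R2_def val_wcomm_eq_one_iff
        val_append val_winv val_wpow pow m_assoc group_axioms)
qed

lemma third_relator_iff:
  assumes "length S = 3" "w \<in> words {..<3}"
  shows "word_value G S (winv gc @ w) = \<one> \<longleftrightarrow> S ! 2 = word_value G S w"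
proof -
  have c: "S ! 2 \<in> carrier G" "word_value G S w \<in> carrier G" using assms by simp_all
  have "word_value G S (winv gc @ w) = inv (S ! 2) \<otimes> word_value G S w"
    using assms by (simp add: val_append val_winv)
  then show ?thesis using c by (metis inv_closed inv_equality inv_inv l_inv)
qed

lemma thompson_word_trivial:
  assumes "thompson_pair G (S ! 0) (S ! 1)" "2 \<le> length S"
    and "w \<in> words {..<2}" "word_value order_auts [x0, x1] w = id"
  shows "word_value G S w = \<one>"
proof -
  obtain x y T where S: "S = [x, y] @ T"
    using assms(2) by (auto simp: numeral_2_eq_2 Suc_le_length_iff)
  have "word_value G S w = word_value G [S ! 0, S ! 1] w"
    using word_value_prefix[of w "[x, y]" G T] assms(3) by (simp add: S numeral_2_eq_2)
  then show ?thesis using thompson_pair.thompson_relation_trivial[OF assms(1,3,4)] by simp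
qed

end

section \<open>Substituting a word for the third generator\<close>

definition subst_third :: "nat gword \<Rightarrow> nat gword \<Rightarrow> nat gword" where
  "subst_third v u =
     concat (map (\<lambda>(x, e). if x = 2 then (if e then v else winv v) else [(x, e)]) u)"

lemma subst_third_words:
  "v \<in> words {..<2} \<Longrightarrow> u \<in> words {..<3} \<Longrightarrow> subst_third v u \<in> words {..<2}"
  by (induction u) (auto simp: subst_third_def)

lemma (in marking) val_subst_third:
  assumes len: "length S = 3" and v: "v \<in> words {..<2}" "S ! 2 = word_value G S v"
    and u: "u \<in> words {..<3}"
  shows "word_value G S (subst_third v u) = word_value G S u"
  using u
proof (induction u)
  case (Cons l u)
  have sub: "y \<in> words {..<2} \<Longrightarrow> y \<in> words {..<length S}" for y :: "nat gword"
    by (erule words_mono) (auto simp: len)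
  obtain x e where l: "l = (x, e)" by force
  let ?y = "if x = 2 then (if e then v else winv v) else [(x, e)]"
  have y: "?y \<in> words {..<length S}" using Cons.prems sub v(1) by (simp add: l len)
  have "subst_third v u \<in> words {..<length S}"
    using Cons.prems v(1) by (intro sub subst_third_words) simp_all
  moreover have "word_value G S ?y = letter_value G S l"
    using v sub Cons.prems by (auto simp: letter_value_def l val_winv len)
  moreover have "subst_third v (l # u) = ?y @ subst_third v u"
    by (simp add: subst_third_def l)
  ultimately show ?case using Cons y by (simp add: val_append)
qed (simp add: subst_third_def)

lemma marking_order_auts:
  "g \<in> carrier order_auts \<Longrightarrow> marking order_auts [x0, x1, g]"
  using group_order_auts thompson.a_closed thompson.b_closed
  by (simp add: marking_def marking_axioms_def)

text \<open>From left to right this is the universal property. For the converse \<open>c\<close> is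
  eliminated by substituting \<open>w\<close>, which leaves a word in \<open>a\<close>,
  \<open>b\<close> to which Thompson's presentation applies.\<close>

lemma relation_iff_thompson:
  assumes w: "w \<in> words {..<2}" and g: "g = word_value order_auts [x0, x1] w"
    and u: "u \<in> words {..<3}"
  defines "R \<equiv> {R1, R2, winv gc @ w}"
  shows "word_value (presented_group {..<3} R) (presentation_marking 3 R) u =
           \<one>\<^bsub>presented_group {..<3} R\<^esub> \<longleftrightarrow>
         word_value order_auts [x0, x1, g] u = id"
proof -
  have w3: "w \<in> words {..<3}" using w by (rule words_mono) auto
  have R: "R \<subseteq> words {..<3}" using w3 R1_words R2_words by (auto simp: R_def)
  let ?P = "presented_group {..<3} R" and ?S = "presentation_marking 3 R"
  interpret P: marking ?P ?S by (rule marking_presentation[OF R])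
  interpret base: marking order_auts "[x0, x1]"
    using group_order_auts thompson.a_closed thompson.b_closed
    by (simp add: marking_def marking_axioms_def)
  have "g \<in> carrier order_auts" using w unfolding g by (intro base.val_closed) (simp add: numeral_2_eq_2)
  then interpret F: marking order_auts "[x0, x1, g]" by (rule marking_order_auts)
  have len: "length ?S = 3" "length [x0, x1, g] = 3" by simp_all
  have prefix: "word_value order_auts [x0, x1, g] v = word_value order_auts [x0, x1] v"
    if "v \<in> words {..<2}" for v
    using word_value_prefix[of v "[x0, x1]" order_auts "[g]"] that by (simp add: numeral_2_eq_2)
  have F_rel: "word_value order_auts [x0, x1, g] y = \<one>\<^bsub>order_auts\<^esub>" if "y \<in> R" for y
    using that F.thompson_pair_iff thompson.thompson_pair_axioms F.third_relator_iff[OF len(2) w3] prefix[OF w] g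
    by (auto simp: R_def)
  have P_rel: "word_value ?P ?S y = \<one>\<^bsub>?P\<^esub>" if "y \<in> R" for y
    using presentation_relator[OF R that] .
  have third: "?S ! 2 = word_value ?P ?S w"
    using P.third_relator_iff[OF len(1) w3] P_rel by (simp add: R_def)
  show ?thesis
  proof
    assume "word_value ?P ?S u = \<one>\<^bsub>?P\<^esub>"
    then show "word_value order_auts [x0, x1, g] u = id"
      \<comment> \<open>The family is constant, so any nontrivial filter serves.\<close>
      using presentation_eventually[OF R F.marking_axioms len(2), where F = sequentially and w = u]
        F_rel u by simp
  next
    assume *: "word_value order_auts [x0, x1, g] u = id"
    have sw: "subst_third w u \<in> words {..<2}" using subst_third_words[OF w u] .
    have "word_value order_auts [x0, x1] (subst_third w u) = id"
      using F.val_subst_third[OF len(2) w _ u] prefix[OF sw] prefix[OF w] g * by simp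
    moreover have "thompson_pair ?P (?S ! 0) (?S ! 1)"
      using P.thompson_pair_iff P_rel by (simp add: len R_def)
    ultimately have "word_value ?P ?S (subst_third w u) = \<one>\<^bsub>?P\<^esub>"
      using sw by (intro P.thompson_word_trivial) simp_all
    then show "word_value ?P ?S u = \<one>\<^bsub>?P\<^esub>"
      using P.val_subst_third[OF len(1) w third u] by simp
  qed
qed

section \<open>Products of conjugates of one element by powers of another\<close>

context group
begin

definition conj_pow :: "'a \<Rightarrow> 'a \<Rightarrow> int \<Rightarrow> 'a" where
  "conj_pow a c i = a [^] i \<otimes> c \<otimes> inv (a [^] i)"

definition conj_letter :: "'a \<Rightarrow> 'a \<Rightarrow> int \<times> bool \<Rightarrow> 'a" where
  "conj_letter a c l = conj_pow a (if snd l then c else inv c) (fst l)"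

text \<open>A list of exponents and signs encodes the product, so that one list can be evaluated
  both in the limit group and among the homeomorphisms.\<close>

definition conj_prod :: "'a \<Rightarrow> 'a \<Rightarrow> (int \<times> bool) list \<Rightarrow> 'a" where
  "conj_prod a c L = foldr (\<lambda>l y. conj_letter a c l \<otimes> y) L \<one>"

lemma conj_prod_Nil [simp]: "conj_prod a c [] = \<one>"
  and conj_prod_Cons [simp]: "conj_prod a c (l # L) = conj_letter a c l \<otimes> conj_prod a c L"
  by (simp_all add: conj_prod_def)

context
  fixes a c assumes ac [simp]: "a \<in> carrier G" "c \<in> carrier G"
begin

lemma conj_pow_closed [simp]: "x \<in> carrier G \<Longrightarrow> conj_pow a x i \<in> carrier G"
  by (simp add: conj_pow_def)

lemma conj_letter_closed [simp]: "conj_letter a c l \<in> carrier G"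
  by (simp add: conj_letter_def)

lemma conj_prod_closed [simp]: "conj_prod a c L \<in> carrier G"
  by (induction L) auto

lemma conj_prod_append: "conj_prod a c (L @ M) = conj_prod a c L \<otimes> conj_prod a c M"
  by (induction L) (auto simp: m_assoc)

lemma conj_pow_mult:
  "x \<in> carrier G \<Longrightarrow> y \<in> carrier G \<Longrightarrow>
   conj_pow a x i \<otimes> conj_pow a y i = conj_pow a (x \<otimes> y) i"
  by (simp add: conj_pow_def m_assoc)

lemma conj_pow_add: "x \<in> carrier G \<Longrightarrow> conj_pow a (conj_pow a x i) j = conj_pow a x (j + i)"
  by (simp add: conj_pow_def int_pow_mult inv_mult_group m_assoc)

lemma conj_pow_zero: "x \<in> carrier G \<Longrightarrow> conj_pow a x 0 = x"
  by (simp add: conj_pow_def)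

lemma inv_conj_pow: "x \<in> carrier G \<Longrightarrow> inv (conj_pow a x i) = conj_pow a (inv x) i"
  by (simp add: conj_pow_def inv_mult_group m_assoc)

lemma conj_letter_not: "conj_letter a c (i, \<not> e) = inv (conj_letter a c (i, e))"
  by (simp add: conj_letter_def inv_conj_pow)

lemma pow_conj_prod:
  "a [^] d \<otimes> conj_prod a c L = conj_prod a c (map (\<lambda>l. (d + fst l, snd l)) L) \<otimes> a [^] (d :: int)"
proof (induction L)
  case (Cons l L)
  have "a [^] d \<otimes> conj_letter a c l = conj_letter a c (d + fst l, snd l) \<otimes> a [^] d"
    by (simp add: conj_letter_def conj_pow_def int_pow_mult inv_mult_group m_assoc)
  then have "a [^] d \<otimes> conj_prod a c (l # L) =
               conj_letter a c (d + fst l, snd l) \<otimes> (a [^] d \<otimes> conj_prod a c L)"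
    by (simp flip: m_assoc)
  then show ?case using Cons by (simp add: m_assoc)
qed simp

lemma commute_conj_prod:
  assumes "x \<in> carrier G" "\<And>i. x \<otimes> conj_pow a c i = conj_pow a c i \<otimes> x"
  shows "x \<otimes> conj_prod a c L = conj_prod a c L \<otimes> x"
proof (induction L)
  case (Cons l L)
  have "x \<otimes> conj_letter a c l = conj_letter a c l \<otimes> x"
    using assms by (simp add: conj_letter_def commute_inv flip: inv_conj_pow)
  with Cons assms(1) show ?case by (simp add: commute_mult)
qed (use assms in simp)

text \<open>All the conjugates commute with each other, so the first letter can be carried to an
  opposite letter of the same index, which the balance provides, and cancelled.\<close>

lemma conj_prod_balanced:
  assumes comm: "\<And>i. conj_pow a c i \<otimes> c = c \<otimes> conj_pow a c i"
    and "\<And>i. count_list L (i, True) = count_list L (i, False)"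
  shows "conj_prod a c L = \<one>"
  using assms(2)
proof (induction "length L" arbitrary: L rule: less_induct)
  case less
  \<comment> \<open>This is \<open>comm\<close> for \<open>i - j\<close>, conjugated by
    \<open>a^j\<close>.\<close>
  have conj: "conj_pow a c i \<otimes> conj_pow a c j = conj_pow a c j \<otimes> conj_pow a c i" for i j
    using comm[of "i - j"] conj_pow_mult[of "conj_pow a c (i - j)" c j] conj_pow_mult[of c "conj_pow a c (i - j)" j]
    by (simp add: conj_pow_add)
  show ?case
  proof (cases L)
    case (Cons l M)
    obtain i e where l: "l = (i, e)" by force
    have "count_list L (i, e) = count_list L (i, \<not> e)" using less.prems[of i] by (cases e) auto
    then have "count_list M (i, \<not> e) \<noteq> 0" using Cons l by auto
    then obtain M1 M2 where M: "M = M1 @ (i, \<not> e) # M2" by (metis count_list_0_iff split_list)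
    have "count_list (M1 @ M2) (j, True) = count_list (M1 @ M2) (j, False)" for j
      using less.prems[of j] Cons l M by (cases e) (auto split: if_splits)
    then have IH: "conj_prod a c (M1 @ M2) = \<one>"
      using less.hyps[of "M1 @ M2"] Cons M by simp
    let ?x = "conj_letter a c (i, e)"
    have "?x \<otimes> conj_prod a c M1 = conj_prod a c M1 \<otimes> ?x"
    proof (rule commute_conj_prod)
      fix j
      show "?x \<otimes> conj_pow a c j = conj_pow a c j \<otimes> ?x"
        using conj by (simp add: conj_letter_def commute_inv flip: inv_conj_pow)
    qed simp
    then have "?x \<otimes> (conj_prod a c M1 \<otimes> (inv ?x \<otimes> conj_prod a c M2)) = conj_prod a c (M1 @ M2)"
      by (simp add: conj_prod_append flip: m_assoc) (simp add: m_assoc)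
    then show ?thesis using IH Cons l M by (simp add: conj_prod_append conj_letter_not)
  qed simp
qed

end

end

section \<open>Normal form of words in three generators\<close>

definition conj_word :: "(int \<times> bool) list \<Rightarrow> nat gword" where
  "conj_word L = concat (map (\<lambda>l. wconj (wpow ga (fst l)) [(2, snd l)]) L)"

lemma conj_word_words: "conj_word L \<in> words {..<3}"
  by (induction L) (auto simp: conj_word_def)

context marking
begin

context
  assumes len: "length S = 3"
begin

lemma val_conj_word: "word_value G S (conj_word L) = conj_prod (S ! 0) (S ! 2) L"
proof (induction L)
  case (Cons l L)
  have w: "ga \<in> words {..<length S}" "wpow ga (fst l) \<in> words {..<length S}"
    "[(2, snd l)] \<in> words {..<length S}" "conj_word L \<in> words {..<length S}"
    "wconj (wpow ga (fst l)) [(2, snd l)] \<in> words {..<length S}"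
    using conj_word_words by (simp_all add: len)
  have "word_value G S [(2, snd l)] = (if snd l then S ! 2 else inv (S ! 2))"
    by (simp add: letter_value_def len)
  then have "word_value G S (wconj (wpow ga (fst l)) [(2, snd l)]) = conj_letter (S ! 0) (S ! 2) l"
    using w by (simp only: val_wconj val_wpow conj_letter_def conj_pow_def val_gen len zero_less_numeral)
  moreover have "conj_word (l # L) = wconj (wpow ga (fst l)) [(2, snd l)] @ conj_word L"
    by (simp add: conj_word_def)
  ultimately show ?case using Cons w by (simp only: val_append conj_prod_Cons)
qed (simp add: conj_word_def)

lemma conj_relators:
  "word_value G S (wcomm (wconj (wpow ga i) gc) gc) = \<one> \<longleftrightarrow>
     conj_pow (S ! 0) (S ! 2) i \<otimes> S ! 2 = S ! 2 \<otimes> conj_pow (S ! 0) (S ! 2) i"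
  "word_value G S (wcomm (wconj (wpow ga i) gb) gc) = \<one> \<longleftrightarrow>
     conj_pow (S ! 0) (S ! 1) i \<otimes> S ! 2 = S ! 2 \<otimes> conj_pow (S ! 0) (S ! 1) i"
  by (simp_all add: val_wcomm_eq_one_iff val_wconj val_wpow conj_pow_def len)

text \<open>Letters are absorbed from the left: \<open>a\<close> shifts the indices of the
  conjugates, \<open>b\<close> commutes with all of them, \<open>c\<close> adds a conjugate of index
  0. The word \<open>h\<close> collects the letters \<open>a\<close> and \<open>b\<close>.\<close>

lemma word_normal_form:
  assumes comm: "\<And>i. conj_pow (S ! 0) (S ! 1) i \<otimes> S ! 2 = S ! 2 \<otimes> conj_pow (S ! 0) (S ! 1) i"
    and "u \<in> words {..<3}"
  shows "\<exists>L h. h \<in> words {..<2} \<and> word_value G S u = conj_prod (S ! 0) (S ! 2) L \<otimes> word_value G S h"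
  using assms(2)
proof (induction u)
  case Nil
  show ?case by (rule exI[of _ "[]"], rule exI[of _ "[]"]) simp
next
  case (Cons l u)
  let ?a = "S ! 0" and ?b = "S ! 1" and ?c = "S ! 2"
  have abc: "?a \<in> carrier G" "?b \<in> carrier G" "?c \<in> carrier G" by (simp_all add: len)
  obtain L h where h: "h \<in> words {..<2}"
    and u: "word_value G S u = conj_prod ?a ?c L \<otimes> word_value G S h"
    using Cons by auto
  have hS: "h \<in> words {..<length S}" using h by (rule words_mono) (auto simp: len)
  obtain x e where l: "l = (x, e)" by force
  have x: "x < 3" using Cons.prems l by simp
  then have lc: "letter_value G S l \<in> carrier G" by (simp add: l len)
  note closed = abc lc hS conj_prod_closed[OF abc(1,3)] val_closed[OF hS]
  consider "x = 0" | "x = 1" | "x = 2" using x by linarith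
  then show ?case
  proof cases
    case 1
    define d :: int where "d = (if e then 1 else -1)"
    have "letter_value G S l = ?a [^] d"
      using abc by (auto simp: letter_value_def l 1 d_def int_pow_neg)
    then have "word_value G S (l # u) =
                 conj_prod ?a ?c (map (\<lambda>l. (d + fst l, snd l)) L) \<otimes> word_value G S (l # h)"
      using closed pow_conj_prod[OF abc(1,3), of d L] by (simp add: u flip: m_assoc)
    moreover have "l # h \<in> words {..<2}" using h l 1 by simp
    ultimately show ?thesis by blast
  next
    case 2
    have b: "?b \<otimes> conj_pow ?a ?c i = conj_pow ?a ?c i \<otimes> ?b" for i
    proof -
      \<comment> \<open>The relator of index \<open>-i\<close>, conjugated by \<open>a^i\<close>,
        says that \<open>b\<close> commutes with \<open>a^i c a^-i\<close>.\<close>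
      have "conj_pow ?a (conj_pow ?a ?b (- i)) i \<otimes> conj_pow ?a ?c i =
            conj_pow ?a ?c i \<otimes> conj_pow ?a (conj_pow ?a ?b (- i)) i"
        using comm[of "- i"] abc by (simp add: conj_pow_mult[OF abc(1,3)] conj_pow_closed[OF abc(1,3)])
      then show ?thesis
        using abc by (simp add: conj_pow_add[OF abc(1,3)] conj_pow_zero[OF abc(1,3)])
    qed
    have "letter_value G S l \<otimes> conj_pow ?a ?c i = conj_pow ?a ?c i \<otimes> letter_value G S l" for i
      using b[of i] commute_inv[of "conj_pow ?a ?c i" ?b] abc conj_pow_closed[OF abc(1,3,3), of i]
      by (auto simp: letter_value_def l 2)
    then have "letter_value G S l \<otimes> conj_prod ?a ?c L = conj_prod ?a ?c L \<otimes> letter_value G S l"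
      by (rule commute_conj_prod[OF abc(1,3) lc])
    then have "word_value G S (l # u) = conj_prod ?a ?c L \<otimes> word_value G S (l # h)"
      using closed by (simp add: u flip: m_assoc)
    moreover have "l # h \<in> words {..<2}" using h l 2 by simp
    ultimately show ?thesis by blast
  next
    case 3
    have "letter_value G S l = conj_letter ?a ?c (0, e)"
      using abc by (simp add: letter_value_def l 3 conj_letter_def conj_pow_zero[OF abc(1,3)])
    then have "word_value G S (l # u) = conj_prod ?a ?c ((0, e) # L) \<otimes> word_value G S h"
      using closed lc by (simp add: u m_assoc)
    then show ?thesis using h by blast
  qed
qed

end

end

section \<open>Thompson's group as a group of order automorphisms\<close>

text \<open>The affine pieces are combined by \<open>max\<close> where the slopes increase and by
  \<open>min\<close> where they decrease.\<close>

lemma continuous_on_unit_generators: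
  "continuous_on {0..1} x0" "continuous_on {0..1} x0_inv"
  "continuous_on {0..1} x1" "continuous_on {0..1} x1_inv"
proof -
  have "continuous_on {0..1} (\<lambda>t::real. max (t/2) (max (t - 1/4) (2 * t - 1)))"
    by (intro continuous_intros) auto
  then show "continuous_on {0..1} x0" by (rule continuous_on_eq) (auto simp: x0_def)
  have "continuous_on {0..1} (\<lambda>t::real. min (2 * t) (min (t + 1/4) ((t + 1)/2)))"
    by (intro continuous_intros) auto
  then show "continuous_on {0..1} x0_inv" by (rule continuous_on_eq) (auto simp: x0_inv_def)
  have "continuous_on {0..1} (\<lambda>t::real. min t (max (t/2 + 1/4) (max (t - 1/8) (2 * t - 1))))"
    by (intro continuous_intros) auto
  then show "continuous_on {0..1} x1" by (rule continuous_on_eq) (auto simp: x1_eq)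
  have "continuous_on {0..1} (\<lambda>t::real. max t (min (2 * t - 1/2) (min (t + 1/8) ((t + 1)/2))))"
    by (intro continuous_intros) auto
  then show "continuous_on {0..1} x1_inv" by (rule continuous_on_eq) (auto simp: x1_inv_eq)
qed

lemma dyadic: "of_nat m / 2 ^ k \<in> (dyadics :: real set)"
  unfolding dyadics_def by blast

lemma x0_inv_thompson: "x0_inv \<in> thompson_maps"
  unfolding thompson_maps_def
proof (intro CollectI conjI)
  show "\<forall>t. t \<notin> {0..1} \<longrightarrow> x0_inv t = t" by (auto simp: x0_inv_def)
  have "homeomorphism {0..1} {0..1} x0_inv x0"
    by (rule homeomorphismI; (simp add: continuous_on_unit_generators; fail | auto simp: x0_def x0_inv_def))
  then show "\<exists>h. homeomorphism {0..1} {0..1} x0_inv h" by blast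
  show "strict_mono_on {0..1} x0_inv"
    using strict_mono_x0_inv by (simp add: strict_mono_on_def strict_mono_def)
  \<comment> \<open>An interval without breakpoints in its interior lies on one side of each of
    them, hence in a single affine piece.\<close>
  have aff: "\<exists>k c. \<forall>t\<in>{u..v}. x0_inv t = 2 powi k * t + c"
    if uv: "0 \<le> u" "v \<le> 1" "v \<le> 1/4 \<or> 1/4 \<le> u" "v \<le> 1/2 \<or> 1/2 \<le> u" for u v
  proof -
    consider "v \<le> 1/4" | "1/4 \<le> u" "v \<le> 1/2" | "1/2 \<le> u" using uv by argo
    then show ?thesis
    proof cases
      case 1
      then show ?thesis using uv by (intro exI[of _ 1] exI[of _ 0]) (auto simp: x0_inv_def)
    next
      case 2
      then show ?thesis using uv by (intro exI[of _ 0] exI[of _ "1/4"]) (auto simp: x0_inv_def)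
    next
      case 3
      then show ?thesis using uv
        by (intro exI[of _ "-1"] exI[of _ "1/2"]) (auto simp: x0_inv_def power_int_minus field_simps)
    qed
  qed
  show "\<exists>B\<subseteq>dyadics. finite B \<and> (\<forall>u v. 0 \<le> u \<and> u < v \<and> v \<le> 1 \<and> {u<..<v} \<inter> B = {} \<longrightarrow>
          (\<exists>k c. \<forall>t\<in>{u..v}. x0_inv t = 2 powi k * t + c))"
  proof (intro exI[of _ "{1/4, 1/2}"] conjI allI impI)
    show "{1/4, 1/2} \<subseteq> (dyadics :: real set)" using dyadic[of 1 2] dyadic[of 1 1] by simp
    fix u v :: real
    assume "0 \<le> u \<and> u < v \<and> v \<le> 1 \<and> {u<..<v} \<inter> {1/4, 1/2} = {}"
    then show "\<exists>k c. \<forall>t\<in>{u..v}. x0_inv t = 2 powi k * t + c" by (intro aff) auto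
  qed simp
qed

lemma x1_inv_thompson: "x1_inv \<in> thompson_maps"
  unfolding thompson_maps_def
proof (intro CollectI conjI)
  show "\<forall>t. t \<notin> {0..1} \<longrightarrow> x1_inv t = t" by (auto simp: x1_inv_def)
  have "homeomorphism {0..1} {0..1} x1_inv x1"
    by (rule homeomorphismI; (simp add: continuous_on_unit_generators; fail | auto simp: x1_eq x1_inv_eq))
  then show "\<exists>h. homeomorphism {0..1} {0..1} x1_inv h" by blast
  show "strict_mono_on {0..1} x1_inv" by (auto simp: strict_mono_on_def x1_inv_eq)
  have aff: "\<exists>k c. \<forall>t\<in>{u..v}. x1_inv t = 2 powi k * t + c"
    if uv: "0 \<le> u" "v \<le> 1" "v \<le> 1/2 \<or> 1/2 \<le> u" "v \<le> 5/8 \<or> 5/8 \<le> u" "v \<le> 3/4 \<or> 3/4 \<le> u" for u v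
  proof -
    consider "v \<le> 1/2" | "1/2 \<le> u" "v \<le> 5/8" | "5/8 \<le> u" "v \<le> 3/4" | "3/4 \<le> u" using uv by argo
    then show ?thesis
    proof cases
      case 1
      then show ?thesis using uv by (intro exI[of _ 0] exI[of _ 0]) (auto simp: x1_inv_eq)
    next
      case 2
      then show ?thesis using uv by (intro exI[of _ 1] exI[of _ "-1/2"]) (auto simp: x1_inv_eq)
    next
      case 3
      then show ?thesis using uv by (intro exI[of _ 0] exI[of _ "1/8"]) (auto simp: x1_inv_eq)
    next
      case 4
      then show ?thesis using uv
        by (intro exI[of _ "-1"] exI[of _ "1/2"]) (auto simp: x1_inv_eq power_int_minus field_simps)
    qed
  qed
  show "\<exists>B\<subseteq>dyadics. finite B \<and> (\<forall>u v. 0 \<le> u \<and> u < v \<and> v \<le> 1 \<and> {u<..<v} \<inter> B = {} \<longrightarrow>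
          (\<exists>k c. \<forall>t\<in>{u..v}. x1_inv t = 2 powi k * t + c))"
  proof (intro exI[of _ "{1/2, 5/8, 3/4}"] conjI allI impI)
    show "{1/2, 5/8, 3/4} \<subseteq> (dyadics :: real set)"
      using dyadic[of 1 1] dyadic[of 5 3] dyadic[of 3 2] by simp
    fix u v :: real
    assume "0 \<le> u \<and> u < v \<and> v \<le> 1 \<and> {u<..<v} \<inter> {1/2, 5/8, 3/4} = {}"
    then show "\<exists>k c. \<forall>t\<in>{u..v}. x1_inv t = 2 powi k * t + c" by (intro aff) auto
  qed simp
qed

text \<open>A two-sided inverse in the carrier is the unique value of the definite description in
  \<open>m_inv\<close>. Words then evaluate alike in \<open>thompson_F\<close> and
  \<open>order_auts\<close>.\<close>

lemma inv_thompson_F: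
  assumes "f' \<in> thompson_maps" "\<And>t. f (f' t) = t" "\<And>t. f' (f t) = t"
  shows "inv\<^bsub>thompson_F\<^esub> f = f'"
  unfolding m_inv_def thompson_F_def
proof (rule the_equality)
  fix h
  assume "h \<in> carrier \<lparr>carrier = thompson_maps, mult = (\<circ>), one = id\<rparr> \<and>
    f \<otimes>\<^bsub>\<lparr>carrier = thompson_maps, mult = (\<circ>), one = id\<rparr>\<^esub> h = \<one>\<^bsub>\<lparr>carrier = thompson_maps, mult = (\<circ>), one = id\<rparr>\<^esub> \<and>
    h \<otimes>\<^bsub>\<lparr>carrier = thompson_maps, mult = (\<circ>), one = id\<rparr>\<^esub> f = \<one>\<^bsub>\<lparr>carrier = thompson_maps, mult = (\<circ>), one = id\<rparr>\<^esub>"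
  then have "f (h t) = t" for t by (auto dest: fun_cong[of _ id])
  then show "h = f'" using assms(3) by (metis ext)
qed (use assms in \<open>auto simp: fun_eq_iff\<close>)

lemma word_value_thompson_F:
  assumes "w \<in> words {0, 1}"
  shows "word_value thompson_F [x0, x1] w = word_value order_auts [x0, x1] w"
  using assms
proof (induction w)
  case (Cons l w)
  have "inv\<^bsub>thompson_F\<^esub> x0 = inv\<^bsub>order_auts\<^esub> x0" "inv\<^bsub>thompson_F\<^esub> x1 = inv\<^bsub>order_auts\<^esub> x1"
    by (simp_all add: inv_thompson_F[OF x0_inv_thompson] inv_thompson_F[OF x1_inv_thompson]
        inv_x0 inv_x1 strict_mono_x0 surj_x0 strict_mono_x1 surj_x1)
  then have "letter_value thompson_F [x0, x1] l = letter_value order_auts [x0, x1] l"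
    using Cons.prems by (auto simp: letter_value_def)
  then show ?case using Cons by (simp add: thompson_F_def order_auts_def)
qed (simp add: thompson_F_def)

section \<open>Dynamics of the powers of \<open>x0\<close> near the origin\<close>

abbreviation x0_pow :: "int \<Rightarrow> real \<Rightarrow> real" where
  "x0_pow i \<equiv> x0 [^]\<^bsub>order_auts\<^esub> i"

lemma strict_mono_x0_pow: "strict_mono (x0_pow i)"
  using order_auts.int_pow_closed[OF thompson.a_closed, of i] by simp

lemma x0_pow_add: "x0_pow (i + j) t = x0_pow i (x0_pow j t)"
  using order_auts.int_pow_mult[OF thompson.a_closed, of i j] by simp

lemma x0_pow_0 [simp]: "x0_pow 0 t = t"
  using int_pow_0[of order_auts x0] by simp

lemma x0_pow_inverse [simp]: "x0_pow i (x0_pow (- i) t) = t" "x0_pow (- i) (x0_pow i t) = t"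
  using x0_pow_add[of i "- i" t] x0_pow_add[of "- i" i t] by simp_all

lemma x0_pow_1: "x0_pow 1 t = x0 t"
  using order_auts.int_pow_1[OF thompson.a_closed] by simp

lemma inv_x0_pow: "inv\<^bsub>order_auts\<^esub> x0_pow i = x0_pow (- i)"
  using order_auts.int_pow_neg[OF thompson.a_closed, of i] by simp

lemma x0_pow_nonpos: "t \<le> 0 \<Longrightarrow> x0_pow i t = t"
proof -
  assume t: "t \<le> 0"
  have nat: "x0_pow (int n) t = t" for n
  proof (induction n)
    case (Suc n)
    have "x0 t = t" using t by (auto simp: x0_def)
    then show ?case using Suc x0_pow_add[of "int n" 1 t] by (simp add: x0_pow_1 add.commute)
  qed simp
  show ?thesis
  proof (cases i rule: int_cases2)
    case (nonpos n)
    then show ?thesis using nat[of n] x0_pow_inverse(2)[of "int n" t] by simp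
  qed (simp add: nat)
qed

lemma x0_pow_pos: "0 < t \<Longrightarrow> 0 < x0_pow i t"
  using strict_monoD[OF strict_mono_x0_pow, of 0 t i] x0_pow_nonpos[of 0 i] by simp

lemma x0_pow_le: "x0_pow (int n) t \<le> t"
proof (induction n arbitrary: t)
  case (Suc n)
  have "x0_pow (int (Suc n)) t = x0_pow (int n) (x0 t)"
    using x0_pow_add[of "int n" 1 t] by (simp add: x0_pow_1 add.commute)
  then show ?case using Suc[of "x0 t"] x0_le[of t] by simp
qed simp

text \<open>On \<open>[0, 1/2]\<close> the map \<open>x0\<close> halves, so that \<open>s < 2 r\<close> makes \<open>[r, s]\<close> a wandering interval.\<close>

lemma x0_pow_displaces:
  assumes rs: "0 < r" "s < 2 * r" "s \<le> 1/2" and t: "t \<in> {r..s}" and i: "i \<noteq> 0"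
  shows "x0_pow i t \<notin> {r..s}"
proof -
  have pos: "x0_pow i t < r" if "t \<in> {r..s}" "0 < i" for i t
  proof -
    define n where "n = nat (i - 1)"
    have "x0_pow i t = x0_pow (int n) (x0 t)"
      using x0_pow_add[of "i - 1" 1 t] that by (simp add: x0_pow_1 n_def)
    also have "\<dots> \<le> x0 t" by (rule x0_pow_le)
    \<comment> \<open>Here \<open>0 < t \<le> s \<le> 1/2\<close>, so
      \<open>x0 t = t/2 \<le> s/2 < r\<close>.\<close>
    also have "x0 t < r" using rs that by (auto simp: x0_def)
    finally show ?thesis .
  qed
  show ?thesis
  proof (cases "0 < i")
    case True
    then show ?thesis using pos t by force
  next
    case False
    \<comment> \<open>If the image lay in the interval, the positive power \<open>-i\<close> would
      carry it below \<open>r\<close>; but it carries it back to \<open>t\<close>.\<close>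
    then show ?thesis using pos[of "x0_pow i t" "- i"] i t by auto
  qed
qed

section \<open>Conjugates by powers of \<open>x0\<close>\<close>

lemma conj_pow_apply:
  assumes "g \<in> carrier order_auts"
  shows "order_auts.conj_pow x0 g i t = x0_pow i (g (x0_pow (- i) t))"
  using assms by (simp add: order_auts.conj_pow_def inv_x0_pow)

lemma commute_disjoint:
  assumes "f \<in> carrier order_auts" "g \<in> carrier order_auts" "\<And>t. f t = t \<or> g t = t"
  shows "f \<otimes>\<^bsub>order_auts\<^esub> g = g \<otimes>\<^bsub>order_auts\<^esub> f"
  using disjoint_moves_commute[of f g] assms by (simp add: strict_mono_imp_inj_on)

lemma moved_inverse:
  assumes g: "g \<in> carrier order_auts" and t: "g t = t"
  shows "(inv\<^bsub>order_auts\<^esub> g) t = t"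
  using fun_cong[OF order_auts.l_inv[OF g], of t] t by simp

text \<open>Shows where the product is invisible, so that the factor \<open>h\<close> of the normal
  form can be observed alone.\<close>

lemma conj_prod_fixes:
  assumes g: "g \<in> carrier order_auts"
    and "\<forall>l\<in>set L. g (x0_pow (- fst l) t) = x0_pow (- fst l) t"
  shows "order_auts.conj_prod x0 g L t = t"
  using assms(2)
proof (induction L)
  case (Cons l L)
  have "order_auts.conj_letter x0 g l t = t"
    using Cons.prems g moved_inverse[OF g] conj_pow_apply order_auts.inv_closed[OF g]
    by (simp add: order_auts.conj_letter_def del: order_auts_simps(1) inv_order_auts)
  then show ?case using Cons by simp
qed simp

text \<open>As \<open>x1\<close> is the identity up to 1/2, its conjugate is the identity up to
  \<open>x0_pow i (1/2)\<close>, a range that covers every point moved by \<open>g\<close>.\<close>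

lemma conj_pow_x1_commute:
  assumes g: "g \<in> carrier order_auts" and moved: "{t. g t \<noteq> t} \<subseteq> {r..s}" and s: "s \<le> x0_pow i (1/2)"
  shows "order_auts.conj_pow x0 x1 i \<otimes>\<^bsub>order_auts\<^esub> g = g \<otimes>\<^bsub>order_auts\<^esub> order_auts.conj_pow x0 x1 i"
proof (rule commute_disjoint)
  show "order_auts.conj_pow x0 x1 i \<in> carrier order_auts"
    by (rule order_auts.conj_pow_closed[OF thompson.a_closed g thompson.b_closed])
  fix t
  show "order_auts.conj_pow x0 x1 i t = t \<or> g t = t"
  proof (rule disjCI)
    assume "g t \<noteq> t"
    then have "t \<le> x0_pow i (1/2)" using moved s by force
    then have "x0_pow (- i) t \<le> x0_pow (- i) (x0_pow i (1/2))"
      using strict_mono_less_eq[OF strict_mono_x0_pow] by blast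
    then show "order_auts.conj_pow x0 x1 i t = t"
      by (simp only: conj_pow_apply[OF thompson.b_closed] x0_pow_inverse x1_fixes)
  qed
qed (rule g)

context
  fixes g r s
  assumes g: "g \<in> carrier order_auts" and moved: "{t. g t \<noteq> t} \<subseteq> {r..s}"
    and rs: "0 < r" "s < 2 * r"
begin

lemma conj_pow_commute:
  assumes s: "s \<le> 1/2"
  shows "order_auts.conj_pow x0 g i \<otimes>\<^bsub>order_auts\<^esub> g = g \<otimes>\<^bsub>order_auts\<^esub> order_auts.conj_pow x0 g i"
proof (cases "i = 0")
  case True
  then show ?thesis using g order_auts.conj_pow_zero[OF thompson.a_closed g g] by (simp del: order_auts_simps)
next
  case False
  show ?thesis
  proof (rule commute_disjoint)
    show "order_auts.conj_pow x0 g i \<in> carrier order_auts"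
      by (rule order_auts.conj_pow_closed[OF thompson.a_closed g g])
    fix t
    show "order_auts.conj_pow x0 g i t = t \<or> g t = t"
    proof (rule disjCI)
      assume "g t \<noteq> t"
      then have "x0_pow (- i) t \<notin> {r..s}" using moved False by (intro x0_pow_displaces[OF rs s]) auto
      then have "g (x0_pow (- i) t) = x0_pow (- i) t" using moved by blast
      then show "order_auts.conj_pow x0 g i t = t" by (simp only: conj_pow_apply[OF g] x0_pow_inverse)
    qed
  qed (rule g)
qed

text \<open>On the translate \<open>x0\<^sup>i [r, s]\<close> only the conjugates with index \<open>i\<close> act.\<close>

lemma conj_prod_acts:
  fixes i :: int
  assumes s: "s \<le> 1/2" and t: "t \<in> {r..s}"
  defines "e \<equiv> \<lambda>L. int (count_list L (i, True)) - int (count_list L (i, False))"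
  shows "order_auts.conj_prod x0 g L (x0_pow i t) = x0_pow i ((g [^]\<^bsub>order_auts\<^esub> e L) t)
         \<and> (g [^]\<^bsub>order_auts\<^esub> e L) t \<in> {r..s}"
proof (induction L)
  case Nil
  show ?case using t int_pow_0[of order_auts g] by (simp add: e_def)
next
  case (Cons l L)
  let ?p = "\<lambda>n::int. g [^]\<^bsub>order_auts\<^esub> n"
  obtain j b where l: "l = (j, b)" by force
  let ?g = "if b then g else inv\<^bsub>order_auts\<^esub> g"
  have g': "?g \<in> carrier order_auts" using g order_auts.inv_closed[OF g] by (simp del: order_auts_simps inv_order_auts)
  have moved': "{t. ?g t \<noteq> t} \<subseteq> {r..s}"
    using moved moved_inverse[OF g] by auto
  define t' where "t' = ?p (e L) t"
  have t': "t' \<in> {r..s}" and IH: "order_auts.conj_prod x0 g L (x0_pow i t) = x0_pow i t'"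
    using Cons by (simp_all add: t'_def)
  have "order_auts.conj_prod x0 g (l # L) (x0_pow i t) = x0_pow j (?g (x0_pow (- j) (x0_pow i t')))"
    using conj_pow_apply[OF g'] IH by (simp add: order_auts.conj_letter_def l)
  also have "x0_pow (- j) (x0_pow i t') = x0_pow (i - j) t'"
    using x0_pow_add[of "- j" i t'] by simp
  finally have val: "order_auts.conj_prod x0 g (l # L) (x0_pow i t) = x0_pow j (?g (x0_pow (i - j) t'))" .
  show ?case
  proof (cases "i = j")
    case True
    define d :: int where "d = (if b then 1 else -1)"
    have "e (l # L) = d + e L" by (auto simp: e_def l True d_def)
    moreover have "?p d = ?g"
      using order_auts.int_pow_1[OF g] order_auts.int_pow_neg[OF g, of 1] by (simp add: d_def)
    ultimately have "?p (e (l # L)) t = ?g t'"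
      using order_auts.int_pow_mult[OF g, of d "e L"] by (simp add: t'_def)
    moreover have "?g t' \<in> {r..s}"
    proof (rule ccontr)
      \<comment> \<open>A point outside the interval is fixed, and by injectivity it would then
        equal its preimage \<open>t'\<close>, which lies inside.\<close>
      assume n: "?g t' \<notin> {r..s}"
      then have "?g (?g t') = ?g t'" using moved' by blast
      moreover have "inj ?g" using g' by (simp only: order_auts_simps(1) strict_mono_imp_inj_on)
      ultimately show False using n t' by (metis injD)
    qed
    ultimately show ?thesis using val True by simp
  next
    case False
    \<comment> \<open>Pulled back by the power of index \<open>j\<close>, the point lies outside the
      interval, where \<open>g\<close> does nothing.\<close>
    then have "x0_pow (i - j) t' \<notin> {r..s}" by (intro x0_pow_displaces[OF rs s t']) simp
    then have "?g (x0_pow (i - j) t') = x0_pow (i - j) t'" using moved' by blast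
    moreover have "e (l # L) = e L" using False by (simp add: e_def l)
    ultimately show ?thesis using val t' x0_pow_add[of j "i - j" t'] by (simp add: t'_def)
  qed
qed

end

text \<open>By monotonicity all positive powers of \<open>g\<close> send a moved point
  \<open>t\<close> to the same side of \<open>t\<close>, so it is never periodic.\<close>

lemma order_aut_power_fixed:
  assumes g: "g \<in> carrier order_auts" and t: "g t \<noteq> t" and e: "(g [^]\<^bsub>order_auts\<^esub> (e::int)) t = t"
  shows "e = 0"
proof -
  let ?p = "\<lambda>n::nat. g [^]\<^bsub>order_auts\<^esub> n"
  have mono: "strict_mono (?p n)" for n
    using order_auts.nat_pow_closed[OF g, of n] by simp
  have Suc: "?p (Suc n) t = ?p n (g t)" for n by simp
  have "?p (Suc n) t \<noteq> t" for n
  proof (cases "t < g t")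
    case True
    have "t < ?p (Suc n) t"
    proof (induction n)
      case (Suc n)
      then show ?case using strict_monoD[OF mono True, of "Suc n"] Suc by simp
    qed (use True order_auts.nat_pow_0[of g] in simp)
    then show ?thesis by simp
  next
    case False
    then have less: "g t < t" using t by simp
    have "?p (Suc n) t < t"
    proof (induction n)
      case (Suc n)
      then show ?case using strict_monoD[OF mono less, of "Suc n"] Suc by simp
    qed (use less order_auts.nat_pow_0[of g] in simp)
    then show ?thesis by simp
  qed
  then have nat: "?p n t = t \<Longrightarrow> n = 0" for n by (cases n) auto
  show ?thesis
  proof (cases e rule: int_cases2)
    case (nonneg n)
    then show ?thesis using nat[of n] e by (simp add: int_pow_int)
  next
    case (nonpos n)
    \<comment> \<open>If a negative power fixes \<open>t\<close>, then so does the opposite positive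
      one.\<close>
    have "?p n \<otimes>\<^bsub>order_auts\<^esub> (g [^]\<^bsub>order_auts\<^esub> (- int n)) = \<one>\<^bsub>order_auts\<^esub>"
      using order_auts.int_pow_neg_int[OF g, of n] order_auts.r_inv[OF order_auts.nat_pow_closed[OF g]]
      by (simp del: order_auts_simps)
    then have "?p n t = t" using e fun_cong[of _ id t] by (simp add: nonpos) (metis comp_apply id_apply)
    then show ?thesis using nat nonpos by simp
  qed
qed

section \<open>The limit\<close>

theorem theorem4p4:
  fixes g :: "nat \<Rightarrow> real \<Rightarrow> real" and r s :: "nat \<Rightarrow> real" and w :: "nat \<Rightarrow> nat gword"
  assumes "\<And>n. g n \<in> carrier thompson_F"
    and "\<And>n. supp (g n) \<subseteq> {r n..s n}"
    and "\<And>n. {r n..s n} \<subseteq> {0..1}"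
    and "\<And>n. r n < s n"
    and "\<And>n. s n < 2 * r n"
    and "r \<longlonglongrightarrow> 0"
    and "eventually (\<lambda>n. g n \<noteq> id) sequentially"
    and "\<And>n. w n \<in> words {0, 1}"
    and "\<And>n. word_value thompson_F [x0, x1] (w n) = g n"
  shows "limitin (marked_topology 3)
           (\<lambda>n. marked_presentation 3 {R1, R2, winv gc @ w n})
           (marked_presentation 3
              ({R1, R2}
               \<union> {wcomm (wconj (wpow ga i) gc) gc | i. True}
               \<union> {wcomm (wconj (wpow ga i) gb) gc | i. True}))
           sequentially"
proof -
  define R where "R = {R1, R2}
               \<union> {wcomm (wconj (wpow ga i) gc) gc | i. True}
               \<union> {wcomm (wconj (wpow ga i) gb) gc | i. True}"
  let ?Q = "\<lambda>n. {R1, R2, winv gc @ w n}"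
  let ?P = "presented_group {..<3} R" and ?S = "presentation_marking 3 R"
  let ?T = "\<lambda>n. [x0, x1, g n]"

  \<comment> \<open>The elements \<open>g n\<close> as order automorphisms moving points only near
    0\<close>
  have w2: "w n \<in> words {..<2}" for n
    using assms(8)[of n] by (rule words_mono) auto
  have g_word: "g n = word_value order_auts [x0, x1] (w n)" for n
    using assms(9)[of n] word_value_thompson_F[OF assms(8)[of n]] by simp
  have g: "g n \<in> carrier order_auts" for n
  proof -
    interpret marking order_auts "[x0, x1]"
      using group_order_auts thompson.a_closed thompson.b_closed
      by (simp add: marking_def marking_axioms_def)
    show ?thesis unfolding g_word using w2[of n] by (intro val_closed) (simp add: numeral_2_eq_2)
  qed
  have moved: "{t. g n t \<noteq> t} \<subseteq> {r n..s n}" for n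
    using assms(2)[of n] closure_subset[of "{t. g n t \<noteq> t}"] by (auto simp: supp_def)
  have r: "0 < r n" for n using assms(4,5)[of n] by linarith
  have small: "\<forall>\<^sub>F n in sequentially. s n < \<delta>" if "0 < \<delta>" for \<delta>
  proof -
    have "\<forall>\<^sub>F n in sequentially. r n < \<delta> / 2" using assms(6) that by (intro order_tendstoD(2)) auto
    then show ?thesis
    proof eventually_elim
      case (elim n)
      then show ?case using assms(5)[of n] by linarith
    qed
  qed
  have R12: "R1 \<in> words {..<3}" "R2 \<in> words {..<3}" by (intro R1_words R2_words; simp)+
  have RW: "R \<subseteq> words {..<3}" using R12 by (auto simp: R_def)
  have w3: "w n \<in> words {..<3}" for n using w2[of n] by (rule words_mono) auto
  have QW: "?Q n \<subseteq> words {..<3}" for n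
    using w3[of n] R12 by simp
  have T: "marking order_auts (?T n)" for n using g by (rule marking_order_auts)
  interpret P: marking ?P ?S by (rule marking_presentation[OF RW])
  have len: "length ?S = 3" "length (?T n) = 3" for n by simp_all
  have P_rel: "word_value ?P ?S u = \<one>\<^bsub>?P\<^esub>" if "u \<in> R" for u
    using presentation_relator[OF RW that] .

  \<comment> \<open>Each relator of the limit holds for large \<open>n\<close>\<close>
  have T_rel: "\<forall>\<^sub>F n in sequentially. word_value order_auts (?T n) u = \<one>\<^bsub>order_auts\<^esub>" if "u \<in> R" for u
  proof -
    have "u = R1 \<or> u = R2 \<or> (\<exists>i. u = wcomm (wconj (wpow ga i) gc) gc) \<or>
          (\<exists>i. u = wcomm (wconj (wpow ga i) gb) gc)"
      using that by (auto simp: R_def)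
    then consider "u = R1" | "u = R2" | i where "u = wcomm (wconj (wpow ga i) gc) gc"
      | i where "u = wcomm (wconj (wpow ga i) gb) gc" by blast
    then show ?thesis
    proof cases
      case 1
      then show ?thesis
        using marking.thompson_pair_iff[OF T] thompson.thompson_pair_axioms by (intro always_eventually) auto
    next
      case 2
      then show ?thesis
        using marking.thompson_pair_iff[OF T] thompson.thompson_pair_axioms by (intro always_eventually) auto
    next
      case (3 i)
      have "\<forall>\<^sub>F n in sequentially. s n < 1/2" by (rule small) simp
      then show ?thesis
      proof eventually_elim
        case (elim n)
        then show ?case
          using conj_pow_commute[OF g moved r assms(5), of n i] marking.conj_relators(1)[OF T len(2), of n i]
          by (simp add: 3 del: order_auts_simps)
      qed
    next
      case (4 i)
      \<comment> \<open>The point \<open>x0_pow i (1/2)\<close> is positive and independent of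
        \<open>n\<close>, so the shrinking supports pass below it.\<close>
      have "\<forall>\<^sub>F n in sequentially. s n < x0_pow i (1/2)" by (intro small x0_pow_pos) simp
      then show ?thesis
      proof eventually_elim
        case (elim n)
        then show ?case
          using conj_pow_x1_commute[OF g moved, of n i] marking.conj_relators(2)[OF T len(2), of n i]
          by (simp add: 4 del: order_auts_simps)
      qed
    qed
  qed
  have T_trivial: "\<forall>\<^sub>F n in sequentially. word_value order_auts (?T n) u = id"
    if "u \<in> words {..<3}" "word_value ?P ?S u = \<one>\<^bsub>?P\<^esub>" for u
    using presentation_eventually[OF RW T len(2) T_rel that] by simp

  \<comment> \<open>Words trivial for infinitely many \<open>n\<close> are trivial in the
    limit\<close>
  have P_trivial: "word_value ?P ?S u = \<one>\<^bsub>?P\<^esub>"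
    if u: "u \<in> words {..<3}" and freq: "\<exists>\<^sub>F n in sequentially. word_value order_auts (?T n) u = id" for u
  proof -
    have rel: "wcomm (wconj (wpow ga i) gc) gc \<in> R" "wcomm (wconj (wpow ga i) gb) gc \<in> R" for i
      by (auto simp: R_def)
    note comm = P.conj_relators(1)[OF len(1), THEN iffD1, OF P_rel[OF rel(1)]]
      P.conj_relators(2)[OF len(1), THEN iffD1, OF P_rel[OF rel(2)]]
    obtain L h where h: "h \<in> words {..<2}"
      and nf: "word_value ?P ?S u = P.conj_prod (?S ! 0) (?S ! 2) L \<otimes>\<^bsub>?P\<^esub> word_value ?P ?S h"
      using P.word_normal_form[OF len(1) comm(2) u] by blast
    have h3: "h \<in> words {..<3}" using h by (rule words_mono) auto
    let ?v = "conj_word L @ h"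
    have v3: "?v \<in> words {..<3}" using h3 conj_word_words by simp
    have "word_value ?P ?S ?v = word_value ?P ?S u"
      using h3 conj_word_words[of L] by (simp add: P.val_append P.val_conj_word[OF len(1)] nf)
    \<comment> \<open>The normal form is an identity of the limit group; written as the relation
      \<open>u v^-1\<close> it transfers to the homeomorphisms for all large \<open>n\<close>, in
      particular for infinitely many of those where \<open>u\<close> is trivial.\<close>
    then have "word_value ?P ?S (u @ winv ?v) = \<one>\<^bsub>?P\<^esub>"
      using u v3 P.val_append[of u "winv ?v"] P.val_winv[of ?v] by simp
    then have "\<forall>\<^sub>F n in sequentially. word_value order_auts (?T n) (u @ winv ?v) = id"
      using u v3 by (intro T_trivial) simp_all
    then have "\<exists>\<^sub>F n in sequentially. word_value order_auts (?T n) u = id \<and>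
                 word_value order_auts (?T n) (u @ winv ?v) = id"
      using freq by (rule frequently_eventually_frequently[rotated])
    moreover have "order_auts.conj_prod x0 (g n) L (word_value order_auts [x0, x1] h t) = t"
      if "word_value order_auts (?T n) u = id" "word_value order_auts (?T n) (u @ winv ?v) = id" for n t
    proof -
      interpret F: marking order_auts "?T n" by (rule T)
      note F_val = F.val_append[unfolded len] F.val_winv[unfolded len] F.val_closed[unfolded len]
      have closed: "word_value order_auts (?T n) ?v \<in> carrier order_auts"
        using v3 by (rule F_val(3))
      have "inv\<^bsub>order_auts\<^esub> (word_value order_auts (?T n) ?v) = \<one>\<^bsub>order_auts\<^esub>"
        using that u v3 F_val(1)[of u "winv ?v"] F_val(2)[of ?v]
          order_auts.l_one[OF order_auts.inv_closed[OF closed]]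
        by (simp del: order_auts_simps(1,2) inv_order_auts)
      then have "word_value order_auts (?T n) ?v = \<one>\<^bsub>order_auts\<^esub>"
        using closed order_auts.inv_inv order_auts.inv_one by metis
      moreover have "word_value order_auts (?T n) h = word_value order_auts [x0, x1] h"
        using word_value_prefix[of h "[x0, x1]" order_auts "[g n]"] h by (simp add: numeral_2_eq_2)
      ultimately show ?thesis
        using h3 conj_word_words[of L] F.val_conj_word[OF len(2)]
        by (simp add: F_val(1) fun_eq_iff del: order_auts_simps(1) inv_order_auts)
    qed
    ultimately have freq': "\<exists>\<^sub>F n in sequentially. \<forall>t.
        order_auts.conj_prod x0 (g n) L (word_value order_auts [x0, x1] h t) = t"
      by (auto elim: frequently_elim1)
    text \<open>A point \<open>t > 0\<close> is eventually to the right of the support of the product of conjugates,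
      whereas \<open>h\<close> does not depend on \<open>n\<close>.\<close>
    have h_id: "word_value order_auts [x0, x1] h = id"
    proof
      fix t
      have "\<forall>\<^sub>F n in sequentially. g n (x0_pow (- i) t) = x0_pow (- i) t" for i
      proof (cases "0 < t")
        case True
        have "\<forall>\<^sub>F n in sequentially. s n < x0_pow (- i) t" by (intro small x0_pow_pos True)
        then show ?thesis
        proof eventually_elim
          case (elim n)
          then show ?case using moved[of n] by force
        qed
      next
        case False
        then have "x0_pow (- i) t = t" by (intro x0_pow_nonpos) simp
        moreover have "g n t = t" for n using False moved[of n] r[of n] by force
        ultimately show ?thesis by simp
      qed
      then have "\<forall>\<^sub>F n in sequentially. \<forall>l\<in>set L. g n (x0_pow (- fst l) t) = x0_pow (- fst l) t"
        by (intro eventually_ball_finite) auto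
      then obtain n where fixed: "order_auts.conj_prod x0 (g n) L t = t"
        and one: "order_auts.conj_prod x0 (g n) L (word_value order_auts [x0, x1] h t) = t"
        using frequently_ex[OF frequently_eventually_frequently[OF freq']] conj_prod_fixes[OF g] by blast
      have "inj (order_auts.conj_prod x0 (g n) L)"
        using order_auts.conj_prod_closed[OF thompson.a_closed g, of n L] by (simp add: strict_mono_imp_inj_on)
      then show "word_value order_auts [x0, x1] h t = id t" using fixed one by (metis injD id_apply)
    qed
    \<comment> \<open>A single such \<open>n\<close> determines all exponents, because
      \<open>L\<close> is the same for every \<open>n\<close>.\<close>
    have "\<forall>\<^sub>F n in sequentially. s n < 1/2 \<and> g n \<noteq> id"
      using small[of "1/2"] assms(7) by (simp add: eventually_conj)
    then obtain n where n: "s n < 1/2" "g n \<noteq> id" and one: "\<And>t. order_auts.conj_prod x0 (g n) L t = t"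
      using frequently_ex[OF frequently_eventually_frequently[OF freq']] by (auto simp: h_id)
    obtain t where t: "g n t \<noteq> t" using n(2) by fastforce
    then have J: "t \<in> {r n..s n}" using moved by blast
    have "count_list L (i, True) = count_list L (i, False)" for i
    proof -
      let ?e = "int (count_list L (i, True)) - int (count_list L (i, False))"
      \<comment> \<open>The product is the identity, and its action on the translate of the interval
        by \<open>x0_pow i\<close> isolates the total exponent \<open>?e\<close> of index
        \<open>i\<close>.\<close>
      have "x0_pow i ((g n [^]\<^bsub>order_auts\<^esub> ?e) t) = x0_pow i t"
        using conj_prod_acts[OF g moved r assms(5) _ J, of L i] one n(1) by simp
      then have "(g n [^]\<^bsub>order_auts\<^esub> ?e) t = t" by (metis x0_pow_inverse(2))
      then have "?e = 0" by (rule order_aut_power_fixed[OF g t])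
      then show ?thesis by simp
    qed
    moreover have "?S ! 0 \<in> carrier ?P" "?S ! 2 \<in> carrier ?P" by (rule P.nth_closed; simp)+
    ultimately have "P.conj_prod (?S ! 0) (?S ! 2) L = \<one>\<^bsub>?P\<^esub>"
      using comm(1) by (intro P.conj_prod_balanced)
    \<comment> \<open>The word \<open>h\<close> is trivial as a homeomorphism, hence in every group
      satisfying \<open>R1\<close> and \<open>R2\<close>.\<close>
    moreover have "word_value ?P ?S h = \<one>\<^bsub>?P\<^esub>"
      using P_rel[of R1] P_rel[of R2] P.thompson_pair_iff h h_id
      by (intro P.thompson_word_trivial) (simp_all add: R_def)
    ultimately show ?thesis by (simp add: nf)
  qed

  \<comment> \<open>Convergence from eventual agreement word by word\<close>
  show ?thesis
    unfolding R_def[symmetric]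
  proof (rule limitin_marked_topologyI)
    fix u :: "nat gword" assume u: "u \<in> words {..<3}"
    have Q: "u \<in> marked_relations 3 (marked_presentation 3 (?Q n)) \<longleftrightarrow>
               word_value order_auts (?T n) u = id" for n
      using u relation_iff_thompson[OF w2 g_word u] by (simp add: marked_relations_presentation[OF QW])
    have D: "u \<in> marked_relations 3 (marked_presentation 3 R) \<longleftrightarrow> word_value ?P ?S u = \<one>\<^bsub>?P\<^esub>"
      using u by (simp add: marked_relations_presentation[OF RW])
    show "\<forall>\<^sub>F n in sequentially. u \<in> marked_relations 3 (marked_presentation 3 (?Q n)) \<longleftrightarrow>
            u \<in> marked_relations 3 (marked_presentation 3 R)"
      unfolding Q D
    proof (cases "word_value ?P ?S u = \<one>\<^bsub>?P\<^esub>")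
      case True
      then show "\<forall>\<^sub>F n in sequentially. word_value order_auts (?T n) u = id \<longleftrightarrow>
                   word_value ?P ?S u = \<one>\<^bsub>?P\<^esub>"
        using T_trivial[OF u] by simp
    next
      case False
      then show "\<forall>\<^sub>F n in sequentially. word_value order_auts (?T n) u = id \<longleftrightarrow>
                   word_value ?P ?S u = \<one>\<^bsub>?P\<^esub>"
        using P_trivial[OF u] by (auto simp: frequently_def)
    qed
  qed (intro marked_presentation_in_space QW RW)+
qed

end
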